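(* Let $\xi_0,\xi_1,\xi_2,\dots$ be i.i.d. real- or complex-valued random variables with $\mathbf{P}\{\xi_0=0\}=0$, and for each $n\geqslant 1$ let $G_n(z)=\xi_n z^n+\xi_{n-1}z^{n-1}+\dots+\xi_1 z+\xi_0$. Let $\tau=\tau_n\in\{0,\dots,n\}$ be the smallest index such that $|\xi_\tau|\geqslant|\xi_j|$ for all $j=0,\dots,n$. Let $w_1,\dots,w_n$ be the complex roots of the two equations $$z^{\tau}+\frac{\xi_{0}}{\xi_{\tau}}=0,\qquad z^{n-\tau}+\frac{\xi_{\tau}}{\xi_{n}}=0$$ taken together (the $\tau$ roots of the first and the $n-\tau$ roots of the second). If the distribution of $\log(1+\log(1+|\xi_0|))$ has a slowly varying tail, then for any $\varepsilon\in(0,1)$ $$\mathbf{P}\{F_n(\varepsilon)\}\to 1,\quad n\to\infty,$$ where $F_n(\varepsilon)$ denotes the event that it is possible to enumerate the roots $z_1,\dots,z_n$ of $G_n$ in such a way that $$|z_k-w_k|<\frac{\varepsilon}{n}|w_k|\quad\text{for } k=1,\dots,n.$$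
   Context: A non-negative random variable $X$ has a slowly varying tail if $T(x)=\mathbf{P}\{X>x\}$ is positive for all $x>0$ and $T(cx)/T(x)\to 1$ as $x\to\infty$ for every $c>0$. The roots of $G_n$ (almost surely of degree $n$) are counted with multiplicity. If $\tau=0$ the first equation reads $1+1=0$ and contributes no roots; if $\tau=n$ the second equation reads $1+1=0$ and contributes no roots; so in all cases the two equations have $n$ roots in total, counted with multiplicity across the two equations. *)

theory Defs
  imports "HOL-Probability.Probability" "HOL-Computational_Algebra.Computational_Algebra"
begin

definition tail_prob :: "'a measure \<Rightarrow> ('a \<Rightarrow> real) \<Rightarrow> real \<Rightarrow> real" where
  "tail_prob M X x = measure M {\<omega> \<in> space M. X \<omega> > x}"

definition slowly_varying_tail :: "'a measure \<Rightarrow> ('a \<Rightarrow> real) \<Rightarrow> bool" where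
  "slowly_varying_tail M X \<longleftrightarrow>
     X \<in> borel_measurable M \<and> (\<forall>\<omega>\<in>space M. X \<omega> \<ge> 0) \<and>
     (\<forall>x>0. tail_prob M X x > 0) \<and>
     (\<forall>c>0. ((\<lambda>x. tail_prob M X (c * x) / tail_prob M X x) \<longlongrightarrow> 1) at_top)"

definition iid :: "'a measure \<Rightarrow> (nat \<Rightarrow> 'a \<Rightarrow> complex) \<Rightarrow> bool" where
  "iid M \<xi> \<longleftrightarrow>
     prob_space.indep_vars M (\<lambda>_. borel) \<xi> UNIV \<and>
     (\<forall>i. distr M borel (\<xi> i) = distr M borel (\<xi> 0))"

definition coeff_poly :: "nat \<Rightarrow> (nat \<Rightarrow> complex) \<Rightarrow> complex poly" where
  "coeff_poly n a = (\<Sum>k\<le>n. monom (a k) k)"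

definition max_index :: "nat \<Rightarrow> (nat \<Rightarrow> complex) \<Rightarrow> nat" where
  "max_index n a = (LEAST t. t \<le> n \<and> (\<forall>j\<le>n. norm (a j) \<le> norm (a t)))"

text \<open>
  The roots of the two binomial equations, with multiplicity. For \<open>t = 0\<close> the first polynomial
  is the constant \<open>1 + a 0 / a 0\<close>, for \<open>t = n\<close> the second is \<open>1 + a n / a n\<close>; a constant
  polynomial contributes no roots to \<^const>\<open>proots\<close>.
\<close>
definition binomial_roots :: "nat \<Rightarrow> (nat \<Rightarrow> complex) \<Rightarrow> complex multiset" where
  "binomial_roots n a =
     (let t = max_index n a
      in proots (monom 1 t + [:a 0 / a t:]) + proots (monom 1 (n - t) + [:a t / a n:]))"

definition enumerates :: "nat \<Rightarrow> (nat \<Rightarrow> 'b) \<Rightarrow> 'b multiset \<Rightarrow> bool" where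
  "enumerates n z A \<longleftrightarrow> image_mset z (mset_set {1..n}) = A"

lemma max_index_le: "max_index n a \<le> n"
proof -
  have "finite ((\<lambda>j. norm (a j)) ` {..n})" "(\<lambda>j. norm (a j)) ` {..n} \<noteq> {}"
    by auto
  then have "Max ((\<lambda>j. norm (a j)) ` {..n}) \<in> (\<lambda>j. norm (a j)) ` {..n}"
    by (rule Max_in)
  then obtain t where t: "Max ((\<lambda>j. norm (a j)) ` {..n}) = norm (a t)" "t \<le> n"
    by (elim imageE) simp
  have "\<forall>j\<le>n. norm (a j) \<le> norm (a t)"
    unfolding t(1)[symmetric] by (auto intro!: Max_ge)
  with t(2) have "\<exists>t. t \<le> n \<and> (\<forall>j\<le>n. norm (a j) \<le> norm (a t))"
    by blast
  from LeastI_ex[OF this] show ?thesis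
    unfolding max_index_def by blast
qed

text \<open>
  Division by zero being total, there are \<open>n\<close> roots for every coefficient sequence, so an
  enumeration of \<^const>\<open>binomial_roots\<close> exists at every sample point, not only almost surely.
\<close>
lemma size_binomial_roots: "size (binomial_roots n a) = n"
proof -
  have *: "degree (monom 1 m + [:c:]) = m" for m and c :: complex
  proof (cases "m = 0")
    case False
    then show ?thesis
      by (subst degree_add_eq_left) (auto simp: degree_monom_eq)
  qed (simp add: monom_0)
  show ?thesis
    using max_index_le[of n a]
    by (simp add: binomial_roots_def Let_def size_proots_complex *)
qed

lemma enumerates_binomial_roots_ex: "\<exists>w. enumerates n w (binomial_roots n a)"
proof -
  obtain ws where ws: "mset ws = binomial_roots n a"
    using ex_mset by blast
  then have len: "length ws = n"
    using size_binomial_roots by (metis size_mset)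
  have "map (\<lambda>k. ws ! (k - 1)) [1..<Suc n] = ws"
    using len by (intro nth_equalityI) (auto simp del: upt_Suc)
  then have "image_mset (\<lambda>k. ws ! (k - 1)) (mset [1..<Suc n]) = mset ws"
    by (metis mset_map)
  moreover have "mset [1..<Suc n] = mset_set {1..n}"
    by (metis atLeastLessThanSuc_atLeastAtMost mset_upt)
  ultimately show ?thesis
    using ws unfolding enumerates_def by metis
qed

end

theory Submission
  imports Defs "HOL-Complex_Analysis.Conformal_Mappings" "HOL-Combinatorics.Permutations"
    "HOL-Real_Asymp.Real_Asymp"
begin

text \<open>
  Let \<open>Y_j = ln (1 + ln (1 + |\<xi>_j|))\<close>. For i.i.d. variables with slowly varying tail the maximum of
  \<open>Y_0, \<dots>, Y_n\<close> grows at least linearly in \<open>n\<close> and is more than twice each of the other values,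
  with probability close to one. Hence, with \<open>B = exp (exp (Y_\<tau> / 2))\<close>, all coefficients other than
  \<open>\<xi>_\<tau>\<close> are at most \<open>B\<close> in modulus, \<open>|\<xi>_0|\<close> and \<open>|\<xi>_n|\<close> are at least \<open>1 / B\<close>, and \<open>|\<xi>_\<tau>|\<close>
  exceeds \<open>B (96 n^2 B^2 / \<epsilon>)^n\<close>. For such a polynomial every \<open>w_k\<close> is either tiny or huge, and near it
  only two of the terms of \<open>G_n\<close> matter, so that \<open>|G_n|\<close> is smaller at \<open>w_k\<close> than on the circle of
  radius \<open>\<epsilon> |w_k| / (2 n)\<close> about it. Thus \<open>G_n\<close> has a zero in each of these discs; as they are
  disjoint, these are all the \<open>n\<close> zeros.

  Since \<open>measure\<close> is zero on non-measurable sets, the event has to be shown measurable. This is not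
  immediate: \<open>w\<close> need not depend measurably on the sample point. The event says that an equation with
  measurable coefficients is solvable by some pair \<open>(z, w)\<close> of enumerations in a \<open>\<sigma>\<close>-compact set,
  and by continuity such solvability is expressed by countable quantifiers.
\<close>

subsection \<open>Localisation of the roots\<close>

text \<open>The induction compares the remainder with the one at the real point
  \<open>norm v\<close>, where it is bounded through \<open>1 + x \<le> exp x\<close> and the
  quadratic bound for \<open>exp\<close> on [0, 1].\<close>

lemma norm_one_plus_power_expansion:
  fixes v :: complex
  assumes "real m * norm v \<le> 1"
  shows "norm ((1 + v) ^ m - 1 - of_nat m * v) \<le> (real m * norm v)\<^sup>2"
proof -
  have "norm ((1 + v) ^ m - 1 - of_nat m * v) \<le> (1 + norm v) ^ m - 1 - real m * norm v"
  proof (induction m)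
    case (Suc m)
    have "(1 + v) ^ Suc m - 1 - of_nat (Suc m) * v
        = (1 + v) * ((1 + v) ^ m - 1 - of_nat m * v) + of_nat m * v\<^sup>2"
      by (simp add: algebra_simps power2_eq_square)
    also have "norm \<dots> \<le> norm (1 + v) * norm ((1 + v) ^ m - 1 - of_nat m * v) + real m * (norm v)\<^sup>2"
      by (rule norm_triangle_le) (simp add: norm_mult norm_power)
    also have "\<dots> \<le> (1 + norm v) * ((1 + norm v) ^ m - 1 - real m * norm v) + real m * (norm v)\<^sup>2"
      using Suc.IH norm_triangle_ineq[of 1 v] by (intro add_right_mono mult_mono) auto
    also have "\<dots> = (1 + norm v) ^ Suc m - 1 - real (Suc m) * norm v"
      by (simp add: algebra_simps power2_eq_square)
    finally show ?case .
  qed simp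
  moreover have "(1 + norm v) ^ m \<le> exp (norm v) ^ m"
    by (intro power_mono) auto
  moreover have "exp (norm v) ^ m = exp (real m * norm v)"
    by (simp add: exp_of_nat_mult)
  moreover have "exp (real m * norm v) \<le> 1 + real m * norm v + (real m * norm v)\<^sup>2"
    using assms by (intro exp_bound) auto
  ultimately show ?thesis by linarith
qed

text \<open>Serves both the lower bound for two terms on a circle about their common root and the
  separation of the roots of one binomial.\<close>

lemma norm_one_plus_power_minus_one_ge:
  fixes v :: complex
  assumes "real m * norm v \<le> 1"
  shows "norm ((1 + v) ^ m - 1) \<ge> real m * norm v - (real m * norm v)\<^sup>2"
proof -
  have "norm (of_nat m * v) - norm ((1 + v) ^ m - 1) \<le> norm ((1 + v) ^ m - 1 - of_nat m * v)"
    by (metis norm_minus_commute norm_triangle_ineq2)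
  then show ?thesis
    using norm_one_plus_power_expansion[OF assms] by (simp add: norm_mult)
qed

lemma poly_coeff_poly: "poly (coeff_poly n a) z = (\<Sum>k\<le>n. a k * z ^ k)"
  by (simp add: coeff_poly_def poly_sum poly_monom)

lemma coeff_coeff_poly: "coeff (coeff_poly n a) k = (if k \<le> n then a k else 0)"
  by (simp add: coeff_poly_def coeff_sum)

lemma degree_coeff_poly_le: "degree (coeff_poly n a) \<le> n"
  by (rule degree_le) (simp add: coeff_coeff_poly)

lemma degree_coeff_poly: "a n \<noteq> 0 \<Longrightarrow> degree (coeff_poly n a) = n"
  by (intro antisym degree_coeff_poly_le le_degree) (simp add: coeff_coeff_poly)

text \<open>At \<open>w\<close> the terms \<open>p\<close> and \<open>q\<close> cancel, leaving at
  most \<delta>/(16n) |a_p w^p|; on the circle of radius \<delta>/n |w| their sum alone is at least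
  \<delta>/(4n) |a_p w^p|. A holomorphic function that is smaller at the centre of a disc than on
  its boundary circle has a zero inside.\<close>

lemma root_near_two_term_root:
  fixes a :: "nat \<Rightarrow> complex" and w :: complex and \<delta> :: real
  assumes pq: "p < q" "q \<le> n" and \<delta>: "0 < \<delta>" "\<delta> \<le> 1 / 2"
    and ap: "a p \<noteq> 0" and w: "a p + a q * w ^ (q - p) = 0"
    and rest: "\<And>z. norm (z - w) \<le> \<delta> / n * norm w \<Longrightarrow>
      (\<Sum>j\<in>{..n}-{p,q}. norm (a j) * norm z ^ j) \<le> \<delta> / (16 * n) * (norm (a p) * norm w ^ p)"
  obtains z where "norm (z - w) < \<delta> / n * norm w" "poly (coeff_poly n a) z = 0"
proof -
  have n: "n > 0" using pq by simp
  have w0: "w \<noteq> 0"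
    using pq ap w by (auto simp: power_0_left)
  define f where "f = poly (coeff_poly n a)"
  define g where "g z = (\<Sum>j\<in>{..n}-{p,q}. a j * z ^ j)" for z
  define C where "C = norm (a p) * norm w ^ p"
  have C: "C > 0" using ap w0 by (simp add: C_def)
  have split: "f z = z ^ p * (a p + a q * z ^ (q - p)) + g z" for z
  proof -
    have "f z = (\<Sum>j\<in>insert p (insert q ({..n}-{p,q})). a j * z ^ j)"
      unfolding f_def poly_coeff_poly using pq by (intro sum.cong) auto
    also have "\<dots> = a p * z ^ p + (a q * z ^ q + g z)"
      using pq by (simp add: g_def)
    also have "z ^ q = z ^ p * z ^ (q - p)"
      using pq by (simp flip: power_add)
    finally show ?thesis by (simp add: algebra_simps)
  qed
  have g_le: "norm (g z) \<le> \<delta> / (16 * n) * C" if "norm (z - w) \<le> \<delta> / n * norm w" for z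
  proof -
    have "norm (g z) \<le> (\<Sum>j\<in>{..n}-{p,q}. norm (a j) * norm z ^ j)"
      unfolding g_def by (rule sum_norm_le) (simp add: norm_mult norm_power)
    then show ?thesis using rest[OF that] unfolding C_def by linarith
  qed
  have center: "norm (f w) \<le> \<delta> / (16 * n) * C"
    using g_le[of w] \<delta> w by (simp add: split)
  have bdry: "norm (f z) \<ge> \<delta> / (4 * n) * C - \<delta> / (16 * n) * C" if z: "norm (w - z) = \<delta> / n * norm w" for z
  proof -
    \<comment> \<open>In terms of the relative displacement the two-term factor is
      \<open>- a p * ((1 + u) ^ (q - p) - 1)\<close>, so the estimate for powers near 1
      applies.\<close>
    define u where "u = z / w - 1"
    have zw: "z = w * (1 + u)" using w0 by (simp add: u_def)
    have "norm (w - z) = norm w * norm u"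
      by (simp add: zw algebra_simps norm_mult flip: norm_minus_commute)
    then have "norm w * norm u = norm w * (\<delta> / n)" using z by (simp add: mult.commute)
    then have u: "norm u = \<delta> / n" using w0 by (metis mult_cancel_left norm_eq_zero)
    define x where "x = real (q - p) * norm u"
    have x: "\<delta> / n \<le> x" "x \<le> 1 / 2"
    proof -
      have "1 * norm u \<le> x" unfolding x_def using pq by (intro mult_right_mono) auto
      then show "\<delta> / n \<le> x" using u by simp
      have "x \<le> real n * norm u" unfolding x_def using pq by (intro mult_right_mono) auto
      also have "\<dots> = \<delta>" using u n by simp
      finally show "x \<le> 1 / 2" using \<delta> by simp
    qed
    have xx: "x - x\<^sup>2 \<ge> x / 2"
    proof -
      have "x * x \<le> x * (1 / 2)"
        using x by (intro mult_left_mono) (auto simp: x_def)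
      then show ?thesis by (simp add: power2_eq_square)
    qed
    have pow: "norm ((1 + u) ^ (q - p) - 1) \<ge> \<delta> / (2 * n)"
      using norm_one_plus_power_minus_one_ge[of "q - p" u] x xx unfolding x_def[symmetric] by simp
    have "norm (a p + a q * z ^ (q - p)) = norm (a p) * norm ((1 + u) ^ (q - p) - 1)"
    proof -
      have "a q * w ^ (q - p) = - a p" using w by (simp add: add_eq_0_iff)
      moreover have "a q * z ^ (q - p) = a q * w ^ (q - p) * (1 + u) ^ (q - p)"
        by (simp only: zw power_mult_distrib mult.assoc)
      ultimately have "a p + a q * z ^ (q - p) = - a p * ((1 + u) ^ (q - p) - 1)"
        by (simp add: algebra_simps)
      then show ?thesis by (simp add: norm_mult)
    qed
    then have 1: "norm (a p + a q * z ^ (q - p)) \<ge> norm (a p) * (\<delta> / (2 * n))"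
      using pow by (metis mult_left_mono norm_ge_zero)
    \<comment> \<open>Bernoulli: |1 + u|^p \<ge> 1 - p |u| \<ge> 1 - \<delta> \<ge> 1/2. This factor
      turns \<delta>/(2n) into \<delta>/(4n).\<close>
    have "norm z ^ p \<ge> norm w ^ p * (1 / 2)"
    proof -
      have "1 - norm u \<le> norm (1 + u)"
        using norm_triangle_ineq2[of 1 "-u"] by simp
      moreover have nu: "norm u \<le> 1 / 2"
        using x u by linarith
      ultimately have "(1 - norm u) ^ p \<le> norm (1 + u) ^ p"
        by (intro power_mono) auto
      moreover have "1 + real p * (- norm u) \<le> (1 + - norm u) ^ p"
        using nu by (intro Bernoulli_inequality) auto
      moreover have "real p * norm u \<le> 1 / 2"
      proof -
        have "real p * norm u \<le> real n * norm u" using pq by (intro mult_right_mono) auto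
        also have "\<dots> = \<delta>" using u n by simp
        finally show ?thesis using \<delta> by simp
      qed
      ultimately have "1 / 2 \<le> norm (1 + u) ^ p" by simp
      then show ?thesis
        unfolding zw norm_mult power_mult_distrib by (intro mult_left_mono) auto
    qed
    then have "(norm w ^ p * (1 / 2)) * (norm (a p) * (\<delta> / (2 * n))) \<le> norm z ^ p * norm (a p + a q * z ^ (q - p))"
      using 1 \<delta> by (intro mult_mono) auto
    then have "norm (z ^ p * (a p + a q * z ^ (q - p))) \<ge> \<delta> / (4 * n) * C"
    proof -
      have "(norm w ^ p * (1 / 2)) * (norm (a p) * (\<delta> / (2 * n))) = \<delta> / (4 * n) * C"
        by (simp add: C_def)
      then show ?thesis
        using \<open>norm w ^ p * (1 / 2) * (norm (a p) * (\<delta> / (2 * n))) \<le> _\<close>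
        by (simp only: norm_mult norm_power)
    qed
    moreover have "norm (g z) \<le> \<delta> / (16 * n) * C"
      using z by (intro g_le) (simp add: norm_minus_commute)
    ultimately show ?thesis
      unfolding split using norm_diff_ineq[of "z ^ p * (a p + a q * z ^ (q - p))" "g z"] by linarith
  qed
  have pos: "\<delta> / n * C > 0" using C \<delta> n by simp
  obtain z where "z \<in> ball w (\<delta> / n * norm w)" "f z = 0"
  proof (rule holomorphic_contract_to_zero[of w "\<delta> / n * norm w" f])
    show "continuous_on (cball w (\<delta> / n * norm w)) f"
      unfolding f_def by (intro continuous_intros)
    show "f holomorphic_on ball w (\<delta> / n * norm w)"
      unfolding f_def by (intro holomorphic_intros)
    show "0 < \<delta> / n * norm w" using \<delta> n w0 by simp
    fix z assume "norm (w - z) = \<delta> / n * norm w"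
    \<comment> \<open>In units of \<open>\<delta> / n * C\<close> the circle has at least 1/4 - 1/16
      = 3/16 and the centre at most 1/16.\<close>
    from bdry[OF this] center pos show "norm (f w) < norm (f z)"
      by (simp add: field_simps)
  qed (use that in blast)
  then show ?thesis
    using that[of z] by (simp add: f_def dist_norm norm_minus_commute)
qed

text \<open>Writing \<open>v = w * (1 + u)\<close> gives \<open>(1 + u) ^ m = 1\<close>. For
  \<open>x = m * norm u < 1\<close> the lower bound for powers near 1 then yields x - x^2 \<le> 0,
  which leaves only x = 0.\<close>

lemma power_eq_power_near_imp_eq:
  fixes v w :: complex
  assumes eq: "v ^ m = w ^ m" and near: "real m * norm (v - w) < norm w" and m: "m > 0"
  shows "v = w"
proof -
  have w0: "w \<noteq> 0"
    using near by (smt (verit) norm_ge_zero mult_nonneg_nonneg norm_zero of_nat_0_le_iff)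
  define u where "u = v / w - 1"
  define x where "x = real m * norm u"
  have v: "v = w * (1 + u)" using w0 by (simp add: u_def)
  have "v - w = w * u" by (simp add: v algebra_simps)
  then have "norm (v - w) = norm w * norm u" by (simp add: norm_mult)
  then have "norm w * x < norm w * 1" using near by (simp add: x_def mult.left_commute)
  then have x1: "x < 1" using w0 by (metis mult_less_cancel_left_pos zero_less_norm_iff)
  have "w ^ m * (1 + u) ^ m = w ^ m * 1"
    using eq by (simp add: v power_mult_distrib del: mult_cancel_left1)
  then have "(1 + u) ^ m = 1" using w0 by (simp only: mult_cancel_left) simp
  then have "x - x\<^sup>2 \<le> 0"
    using norm_one_plus_power_minus_one_ge[of m u] x1 by (simp add: x_def)
  then have "x * (1 - x) \<le> 0" by (simp add: power2_eq_square algebra_simps)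
  moreover have "x \<ge> 0" by (simp add: x_def)
  ultimately have "x = 0" using x1 by (simp add: mult_le_0_iff)
  then show ?thesis using m by (simp add: x_def v)
qed

section \<open>Simple roots and enumerations\<close>

text \<open>For \<open>m > 0\<close>, a root shared with the derivative m X^(m-1) could only be 0,
  where the value is \<open>c\<close>. For \<open>m = 0\<close> the polynomial is the constant
  \<open>1 + c\<close>.\<close>

lemma rsquarefree_monom_plus_const:
  fixes c :: "'a :: field_char_0"
  assumes "c \<noteq> 0" "m = 0 \<Longrightarrow> 1 + c \<noteq> 0"
  shows "rsquarefree (monom 1 m + [:c:])"
  using assms
  by (cases "m \<le> 1")
    (auto simp: rsquarefree_roots poly_monom pderiv_add pderiv_monom pderiv_pCons power_0_left le_Suc_eq)

lemma rsquarefree_imp_count_proots_le_1: "rsquarefree p \<Longrightarrow> count (proots p) x \<le> 1"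
  by (auto simp: rsquarefree_def intro: le_SucI)

text \<open>Without repetitions the image multiset is the image set, which therefore has as many
  elements as \<open>A\<close>.\<close>

lemma image_mset_set_eq_imp_inj_on:
  assumes "finite A" and "\<And>x. count (image_mset f (mset_set A)) x \<le> 1"
  shows "inj_on f A"
proof -
  define N where "N = image_mset f (mset_set A)"
  have set: "set_mset N = f ` A"
    using assms(1) by (simp add: N_def)
  have "N = mset_set (f ` A)"
  proof (rule multiset_eqI)
    fix x
    show "count N x = count (mset_set (f ` A)) x"
    proof (cases "x \<in> f ` A")
      case True
      then have "count N x > 0" using set by auto
      moreover have "count N x \<le> 1" using assms(2) by (simp add: N_def)
      ultimately have "count N x = 1" by linarith
      then show ?thesis using True assms(1) by simp
    next
      case False
      then have "count N x = 0" using set by (metis count_eq_zero_iff)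
      then show ?thesis using False by simp
    qed
  qed
  then have "card (f ` A) = size N" by simp
  also have "\<dots> = card A" by (simp add: N_def)
  finally show ?thesis using assms(1) by (simp add: eq_card_imp_inj_on)
qed

text \<open>The distinct roots form a submultiset of \<open>proots p\<close>, and both multisets
  have size \<open>n\<close>.\<close>

lemma enumerates_proots_of_distinct_roots:
  fixes p :: "complex poly"
  assumes "degree p = n" "p \<noteq> 0" "inj_on z {1..n}" "\<And>k. k \<in> {1..n} \<Longrightarrow> poly p (z k) = 0"
  shows "enumerates n z (proots p)"
proof -
  have eq: "image_mset z (mset_set {1..n}) = mset_set (z ` {1..n})"
    using assms(3) by (simp add: image_mset_mset_set)
  have "mset_set (z ` {1..n}) \<subseteq># proots p"
  proof (rule mset_subset_eqI)
    fix x
    show "count (mset_set (z ` {1..n})) x \<le> count (proots p) x"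
    proof (cases "x \<in> z ` {1..n}")
      case True
      then have "poly p x = 0" using assms(4) by auto
      then show ?thesis using True assms(2) by (simp add: order_root Suc_le_eq)
    qed simp
  qed
  moreover have "size (mset_set (z ` {1..n})) = size (proots p)"
    unfolding eq[symmetric] by (simp add: size_proots_complex assms(1))
  ultimately have "mset_set (z ` {1..n}) = proots p"
    using mset_subset_size by (metis less_irrefl subset_mset.le_imp_less_or_eq)
  then show ?thesis by (simp only: enumerates_def eq)
qed

text \<open>Put R = 96 n^2 B^2 / \<epsilon>. The first binomial has its roots in modulus at most
  1/R, where only the terms 0 and \<open>t\<close> matter; the second has its roots in modulus at
  least R, where only the terms \<open>t\<close> and \<open>n\<close> matter. Each root yields a
  zero of the polynomial nearby, and these zeros are distinct.\<close>

lemma roots_close_if_dominant_coeff: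
  fixes a w :: "nat \<Rightarrow> complex" and \<epsilon> B :: real
  assumes n: "n \<ge> 1" and \<epsilon>: "0 < \<epsilon>" "\<epsilon> < 1" and B: "B \<ge> 1"
    and t_def: "t = max_index n a"
    and small: "\<And>j. j \<le> n \<Longrightarrow> j \<noteq> t \<Longrightarrow> norm (a j) \<le> B"
    and a0: "norm (a 0) \<ge> 1 / B" and an: "norm (a n) \<ge> 1 / B"
    and big: "norm (a t) \<ge> B * (96 * (real n)\<^sup>2 * B\<^sup>2 / \<epsilon>) ^ n"
    and w: "enumerates n w (binomial_roots n a)"
  shows "\<exists>z. enumerates n z (proots (coeff_poly n a)) \<and>
    (\<forall>k\<in>{1..n}. norm (z k - w k) < \<epsilon> / n * norm (w k))"
proof -
  \<comment> \<open>Half of the permitted radius: if two discs about roots of the same binomial met,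
    their centres would be closer than \<epsilon>/n times their modulus, which is too close for
    distinct roots.\<close>
  define \<delta> where "\<delta> = \<epsilon> / 2"
  define R where "R = 96 * (real n)\<^sup>2 * B\<^sup>2 / \<epsilon>"
  have t: "t \<le> n" unfolding t_def by (rule max_index_le)
  have \<delta>: "0 < \<delta>" "\<delta> < 1 / 2" using \<epsilon> by (auto simp: \<delta>_def)
  have n2: "(real n)\<^sup>2 \<ge> 1" and B2: "B\<^sup>2 \<ge> 1" using n B by auto
  have "(real n)\<^sup>2 * B\<^sup>2 \<ge> 1 * 1" using n2 B2 by (intro mult_mono) auto
  then have "96 * ((real n)\<^sup>2 * B\<^sup>2) / 1 \<le> R"
    unfolding R_def using \<epsilon> by (subst mult.assoc, intro divide_left_mono) auto
  with \<open>(real n)\<^sup>2 * B\<^sup>2 \<ge> 1 * 1\<close> have R: "R \<ge> 96" by linarith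
  have RR: "1 / R < 1 / 2" "R > 2" using R by (auto simp: field_simps)
  have at: "norm (a t) \<ge> B * R ^ n" using big by (simp add: R_def)
  have "B * R ^ n > 0" using B R by simp
  then have nz: "a 0 \<noteq> 0" "a n \<noteq> 0" "a t \<noteq> 0"
    using a0 an B at by (auto simp: field_simps)
  define P where "P = (monom 1 t + [:a 0 / a t:] :: complex poly)"
  define Q where "Q = (monom 1 (n - t) + [:a t / a n:] :: complex poly)"
  have P_rsf: "rsquarefree P" and Q_rsf: "rsquarefree Q"
    unfolding P_def Q_def using nz t by (auto intro!: rsquarefree_monom_plus_const)
  then have PQ0: "P \<noteq> 0" "Q \<noteq> 0" by (auto simp: rsquarefree_def)
  have roots: "binomial_roots n a = proots P + proots Q"
    by (simp add: binomial_roots_def Let_def P_def Q_def t_def)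

  have smallE: "norm v \<le> 1 / R \<and> t > 0 \<and>
      (\<exists>z. norm (z - v) < \<delta> / n * norm v \<and> poly (coeff_poly n a) z = 0)" if v: "poly P v = 0" for v
  proof -
    have eq: "a 0 + a t * v ^ t = 0"
      using v nz by (simp add: P_def poly_monom field_simps)
    \<comment> \<open>For \<open>t = 0\<close> the equation would read 2 a_0 = 0.\<close>
    have t0: "t > 0"
      using eq nz by (cases "t = 0") auto
    have "v ^ t = - (a 0 / a t)" using v by (simp add: P_def poly_monom add_eq_0_iff)
    then have "norm v ^ t = norm (a 0) / norm (a t)"
      by (metis norm_power norm_minus_cancel norm_divide)
    also have "\<dots> \<le> B / (B * R ^ n)"
      using small[of 0] t0 B at \<open>B * R ^ n > 0\<close> by (intro frac_le) auto
    also have "\<dots> = (1 / R) ^ n" using B by (simp add: power_divide)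
    also have "\<dots> \<le> (1 / R) ^ t"
      using R t by (intro power_decreasing) auto
    finally have v_le: "norm v \<le> 1 / R"
      using t0 R power_mono_iff[of "norm v" "1 / R" t] by simp
    obtain z where "norm (z - v) < \<delta> / n * norm v" "poly (coeff_poly n a) z = 0"
    proof (rule root_near_two_term_root[of 0 t n \<delta> a v])
      show "a 0 + a t * v ^ (t - 0) = 0" using eq by simp
      fix z assume z: "norm (z - v) \<le> \<delta> / n * norm v"
      have "\<delta> / n * norm v \<le> 1 * norm v"
        using \<delta> n by (intro mult_right_mono) (auto simp: field_simps)
      then have z2: "norm z \<le> 2 * norm v"
        using z norm_triangle_sub[of z v] by linarith
      have z1: "norm z \<le> 1" 
        using z2 v_le RR by linarith
      \<comment> \<open>The remaining exponents are at least 1 and |z| \<le> 1, so |z|^j \<le> |z|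
        \<le> 2/R.\<close>
      have "(\<Sum>j\<in>{..n}-{0,t}. norm (a j) * norm z ^ j) \<le> (\<Sum>j\<in>{..n}-{0,t}. B * (2 * (1 / R)))"
      proof (rule sum_mono)
        fix j assume j: "j \<in> {..n}-{0,t}"
        have "norm z ^ j \<le> norm z ^ 1" using j z1 by (intro power_decreasing) auto
        then have "norm z ^ j \<le> 2 * (1 / R)" using z2 v_le by simp
        then show "norm (a j) * norm z ^ j \<le> B * (2 * (1 / R))"
          using small[of j] j B by (intro mult_mono) auto
      qed
      also have "\<dots> = real (card ({..n}-{0,t})) * (B * (2 * (1 / R)))" by simp
      also have "\<dots> \<le> real n * (B * (2 * (1 / R)))"
      proof (intro mult_right_mono)
        have "card ({..n}-{0,t}) \<le> card {1..n}" by (intro card_mono) auto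
        then show "real (card ({..n}-{0,t})) \<le> real n" by simp
      qed (use B R in auto)
      \<comment> \<open>The choice of \<open>R\<close> enters here: 2nB/R = \<epsilon>/(48nB), and
        1/B is a lower bound for |a_0|.\<close>
      also have "\<dots> = \<delta> / (24 * n) * (1 / B)"
        using B n \<epsilon> by (simp add: R_def \<delta>_def field_simps power2_eq_square)
      also have "\<dots> \<le> \<delta> / (16 * n) * (norm (a 0))"
        using a0 \<delta> n B by (intro mult_mono) (auto simp: field_simps)
      finally show "(\<Sum>j\<in>{..n}-{0,t}. norm (a j) * norm z ^ j) \<le> \<delta> / (16 * n) * (norm (a 0) * norm v ^ 0)"
        by simp
    qed (use t0 t \<delta> nz in auto)
    then show ?thesis using v_le t0 by blast
  qed

  have largeE: "norm v \<ge> R \<and> n - t > 0 \<and>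
      (\<exists>z. norm (z - v) < \<delta> / n * norm v \<and> poly (coeff_poly n a) z = 0)" if v: "poly Q v = 0" for v
  proof -
    have eq: "a t + a n * v ^ (n - t) = 0"
      using v nz by (simp add: Q_def poly_monom field_simps)
    \<comment> \<open>For \<open>t = n\<close> the equation would read 2 a_n = 0.\<close>
    have t0: "t < n"
      using eq nz t by (cases "t = n") auto
    have "v ^ (n - t) = - (a t / a n)" using v by (simp add: Q_def poly_monom add_eq_0_iff)
    then have vn: "norm v ^ (n - t) = norm (a t) / norm (a n)"
      by (metis norm_power norm_minus_cancel norm_divide)
    have "R ^ (n - t) \<le> R ^ n" using R by (intro power_increasing) auto
    also have "\<dots> = (B * R ^ n) / B" using B by simp
    also have "\<dots> \<le> norm (a t) / norm (a n)"
      using small[of n] t0 B at nz \<open>B * R ^ n > 0\<close> by (intro frac_le) auto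
    finally have v_ge: "R \<le> norm v"
      using t0 R power_mono_iff[of R "norm v" "n - t"] vn by simp
    obtain z where "norm (z - v) < \<delta> / n * norm v" "poly (coeff_poly n a) z = 0"
    proof (rule root_near_two_term_root[of t n n \<delta> a v])
      fix z assume z: "norm (z - v) \<le> \<delta> / n * norm v"
      have "\<delta> / n * norm v \<le> 1 / 2 * norm v"
        using \<delta> n by (intro mult_right_mono) (auto simp: field_simps)
      then have z2: "norm z \<ge> norm v / 2"
        using z norm_triangle_ineq2[of v z] unfolding norm_minus_commute[of v z] by linarith
      then have z1: "norm z \<ge> 1" using v_ge R by linarith
      have z3: "norm z \<le> (1 + \<delta> / n) * norm v"
        using z norm_triangle_sub[of z v] by (simp add: distrib_right)
      \<comment> \<open>High powers of |z| exceed those of |v| by at most a factor 2, because the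
        relative radius is only \<delta>/n.\<close>
      have "(1 + \<delta> / n) ^ n \<le> exp (\<delta> / n) ^ n"
        using \<delta> by (intro power_mono) auto
      also have "\<dots> = exp \<delta>" using n by (simp flip: exp_of_nat_mult)
      also have "\<dots> \<le> 1 + \<delta> + \<delta>\<^sup>2" using \<delta> by (intro exp_bound) auto
      also have "\<dots> \<le> 2"
        using \<delta> power_mono[of \<delta> "1/2" 2] by (simp add: power2_eq_square)
      finally have e2: "(1 + \<delta> / n) ^ n \<le> 2" .
      have "norm z ^ (n - 1) \<le> ((1 + \<delta> / n) * norm v) ^ (n - 1)"
        using z3 by (intro power_mono) auto
      also have "\<dots> = (1 + \<delta> / n) ^ (n - 1) * norm v ^ (n - 1)"
        by (rule power_mult_distrib)
      also have "\<dots> \<le> (1 + \<delta> / n) ^ n * norm v ^ (n - 1)"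
        using \<delta> by (intro mult_right_mono power_increasing) auto
      also have "\<dots> \<le> 2 * norm v ^ (n - 1)"
        using e2 by (intro mult_right_mono) auto
      finally have z4: "norm z ^ (n - 1) \<le> 2 * norm v ^ (n - 1)" .
      have "(\<Sum>j\<in>{..n}-{t,n}. norm (a j) * norm z ^ j) \<le> (\<Sum>j\<in>{..n}-{t,n}. B * (2 * norm v ^ (n - 1)))"
      proof (rule sum_mono)
        fix j assume j: "j \<in> {..n}-{t,n}"
        have "norm z ^ j \<le> norm z ^ (n - 1)" using j z1 by (intro power_increasing) auto
        then have "norm z ^ j \<le> 2 * norm v ^ (n - 1)" using z4 by simp
        then show "norm (a j) * norm z ^ j \<le> B * (2 * norm v ^ (n - 1))"
          using small[of j] j B by (intro mult_mono) auto
      qed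
      also have "\<dots> = real (card ({..n}-{t,n})) * (B * (2 * norm v ^ (n - 1)))" by simp
      also have "\<dots> \<le> real n * (B * (2 * norm v ^ (n - 1)))"
      proof (intro mult_right_mono)
        have "card ({..n}-{t,n}) \<le> card {..<n}" by (intro card_mono) auto
        then show "real (card ({..n}-{t,n})) \<le> real n" by simp
      qed (use B R in auto)
      \<comment> \<open>A factor \<open>R\<close> is split off so that it can be replaced by one
        more factor |v|. This turns the bound into one by |a_n v^n| = |a_t v^t|.\<close>
      also have "\<dots> = \<delta> / (24 * n) * (1 / B * (norm v ^ (n - 1) * R))"
        using B n \<epsilon> by (simp add: R_def \<delta>_def field_simps power2_eq_square)
      also have "\<dots> \<le> \<delta> / (16 * n) * (norm (a n) * (norm v ^ (n - 1) * norm v))"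
        using an \<delta> n B v_ge R by (intro mult_mono) (auto simp: field_simps)
      also have "norm v ^ (n - 1) * norm v = norm v ^ (n - t) * norm v ^ t"
        using n t by (simp flip: power_add power_Suc2)
      also have "norm (a n) * (norm v ^ (n - t) * norm v ^ t) = norm (a t) * norm v ^ t"
        using nz by (simp add: vn)
      finally show "(\<Sum>j\<in>{..n}-{t,n}. norm (a j) * norm z ^ j) \<le> \<delta> / (16 * n) * (norm (a t) * norm v ^ t)" .
    qed (use t0 t \<delta> nz eq in auto)
    then show ?thesis using v_ge t0 by auto
  qed

  \<comment> \<open>Such a \<open>z\<close> would have modulus below 3/(2R) < 3/4 and above R/2 >
    1.\<close>
  have no_common: False if "poly P v = 0" "poly Q v' = 0" "norm (z - v) < \<delta> / n * norm v"
    "norm (z - v') < \<delta> / n * norm v'" for v v' z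
  proof -
    have *: "\<delta> / n * norm y \<le> 1 / 2 * norm y" for y :: complex
      using \<delta> n by (intro mult_right_mono) (auto simp: field_simps)
    have "norm z < 3 / 2 * norm v"
      using that(3) *[of v] norm_triangle_sub[of z v] by linarith
    moreover have "norm z > 1 / 2 * norm v'"
      using that(4) *[of v'] norm_triangle_ineq2[of v' z] unfolding norm_minus_commute[of v' z] by linarith
    moreover have "norm v \<le> 1 / R" "norm v' \<ge> R" using smallE[OF that(1)] largeE[OF that(2)] by auto
    ultimately show False using RR by linarith
  qed
  have wset: "poly P (w k) = 0 \<or> poly Q (w k) = 0" if "k \<in> {1..n}" for k
  proof -
    have "w k \<in># image_mset w (mset_set {1..n})" using that by simp
    then have "w k \<in># proots P + proots Q"
      using w by (simp only: enumerates_def roots)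
    then show ?thesis using PQ0 by auto
  qed
  have "\<forall>k\<in>{1..n}. \<exists>z. norm (z - w k) < \<delta> / n * norm (w k) \<and> poly (coeff_poly n a) z = 0"
    using wset smallE largeE by meson
  then obtain z where z: "\<And>k. k \<in> {1..n} \<Longrightarrow> norm (z k - w k) < \<delta> / n * norm (w k)"
    "\<And>k. k \<in> {1..n} \<Longrightarrow> poly (coeff_poly n a) (z k) = 0"
    by (metis (no_types))
  \<comment> \<open>Each binomial has simple roots, and no number is a root of both, as 1/R <
    R.\<close>
  have w_inj: "inj_on w {1..n}"
  proof (rule image_mset_set_eq_imp_inj_on)
    fix x
    have "count (proots P) x \<le> 1" "count (proots Q) x \<le> 1"
      by (rule rsquarefree_imp_count_proots_le_1[OF P_rsf] rsquarefree_imp_count_proots_le_1[OF Q_rsf])+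
    moreover have "count (proots P) x = 0 \<or> count (proots Q) x = 0"
    proof (rule ccontr)
      assume "\<not> ?thesis"
      then have "x \<in># proots P" "x \<in># proots Q" by (auto simp: not_in_iff)
      then have "norm x \<le> 1 / R" "norm x \<ge> R" using PQ0 smallE largeE by auto
      then show False using RR by linarith
    qed
    ultimately show "count (image_mset w (mset_set {1..n})) x \<le> 1"
      using w by (auto simp: enumerates_def roots)
  qed simp
  \<comment> \<open>Equal powers give equal moduli, hence discs of equal radius; a common point
    makes the centres closer than 2\<delta>/n = \<epsilon>/n times that modulus.\<close>
  have same: "v = v'" if "v ^ m = v' ^ m" "0 < m" "m \<le> n"
    "norm (y - v) < \<delta> / n * norm v" "norm (y - v') < \<delta> / n * norm v'" for v v' y :: complex and m
  proof (rule power_eq_power_near_imp_eq[OF that(1) _ that(2)])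
    have "norm v ^ m = norm v' ^ m" using that(1) by (metis norm_power)
    then have eq: "norm v = norm v'" using that(2) by (metis norm_ge_zero power_eq_imp_eq_base)
    have "norm (v - v') \<le> norm (y - v) + norm (y - v')"
      using norm_triangle_ineq4[of "y - v'" "y - v"] by simp
    also have "\<dots> < \<delta> / n * norm v' + \<delta> / n * norm v'" using that(4,5) eq by simp
    also have "\<dots> = \<epsilon> / n * norm v'" by (simp add: \<delta>_def)
    finally have d: "norm (v - v') < \<epsilon> / n * norm v'" .
    have "real m * norm (v - v') \<le> real n * norm (v - v')" using that by (intro mult_right_mono) auto
    also have "\<dots> < real n * (\<epsilon> / n * norm v')" using d n by (intro mult_strict_left_mono) auto
    also have "\<dots> \<le> norm v'" using n \<epsilon> by (simp add: mult_left_le_one_le)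
    finally show "real m * norm (v - v') < norm v'" .
  qed
  have z_inj: "inj_on z {1..n}"
  proof (rule inj_onI)
    fix i j assume ij: "i \<in> {1..n}" "j \<in> {1..n}" "z i = z j"
    have zi: "norm (z i - w i) < \<delta> / n * norm (w i)" and zj: "norm (z i - w j) < \<delta> / n * norm (w j)"
      using z(1)[OF ij(1)] z(1)[OF ij(2)] ij(3) by auto
    have "w i = w j"
    proof -
      consider "poly P (w i) = 0" "poly P (w j) = 0" | "poly Q (w i) = 0" "poly Q (w j) = 0"
        using wset[OF ij(1)] wset[OF ij(2)] no_common zi zj by metis
      then show ?thesis
      proof cases
        case 1
        then have "w i ^ t = w j ^ t" by (simp add: P_def poly_monom add_eq_0_iff2)
        then show ?thesis using same[of "w i" t "w j" "z i"] zi zj smallE[OF 1(1)] t by blast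
      next
        case 2
        then have "w i ^ (n - t) = w j ^ (n - t)" by (simp add: Q_def poly_monom add_eq_0_iff2)
        then show ?thesis using same[of "w i" "n - t" "w j" "z i"] zi zj largeE[OF 2(1)] by simp
      qed
    qed
    then show "i = j" using w_inj ij by (simp add: inj_on_eq_iff)
  qed
  have deg: "degree (coeff_poly n a) = n" using nz by (simp add: degree_coeff_poly)
  then have "coeff_poly n a \<noteq> 0" using n by auto
  then have "enumerates n z (proots (coeff_poly n a))"
    using deg z_inj z(2) by (intro enumerates_proots_of_distinct_roots) auto
  moreover have "norm (z k - w k) < \<epsilon> / n * norm (w k)" if "k \<in> {1..n}" for k
  proof -
    have "norm (z k - w k) < \<delta> / n * norm (w k)" using z(1)[OF that] .
    also have "\<dots> \<le> \<epsilon> / n * norm (w k)"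
      using \<epsilon> by (intro mult_right_mono divide_right_mono) (auto simp: \<delta>_def)
    finally show ?thesis .
  qed
  ultimately show ?thesis by blast
qed

subsection \<open>Measurability\<close>

text \<open>A nonnegative continuous function attains its infimum on \<open>K\<close>. It thus has a
  zero there exactly when it takes arbitrarily small values on a countable dense subset of
  \<open>K\<close>.\<close>

lemma sets_Collect_ex_zero_on_compact:
  fixes F :: "'a \<Rightarrow> 'b::{second_countable_topology} \<Rightarrow> real"
  assumes K: "compact K"
    and meas: "\<And>x. (\<lambda>\<omega>. F \<omega> x) \<in> borel_measurable M"
    and cont: "\<And>\<omega>. \<omega> \<in> space M \<Longrightarrow> continuous_on UNIV (F \<omega>)"
    and nonneg: "\<And>\<omega> x. F \<omega> x \<ge> 0"
  shows "{\<omega> \<in> space M. \<exists>x\<in>K. F \<omega> x = 0} \<in> sets M"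
proof -
  obtain \<B> :: "'b set set" where \<B>: "countable \<B>"
    "\<And>C. C \<in> \<B> \<Longrightarrow> open C" "\<And>S. open S \<Longrightarrow> \<exists>U. U \<subseteq> \<B> \<and> S = \<Union>U"
    using univ_second_countable by blast
  \<comment> \<open>One point from each basic open set that meets \<open>K\<close> gives the dense
    subset.\<close>
  define pick where "pick C = (SOME x. x \<in> K \<inter> C)" for C
  define D where "D = pick ` {C\<in>\<B>. K \<inter> C \<noteq> {}}"
  have pick: "pick C \<in> K \<inter> C" if "K \<inter> C \<noteq> {}" for C
    using that unfolding pick_def by (simp only: some_in_eq not_False_eq_True)
  have D: "countable D" "D \<subseteq> K" using \<B>(1) pick by (auto simp: D_def)
  have dense: "\<exists>d\<in>D. d \<in> S" if S: "open S" "x \<in> K" "x \<in> S" for S x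
  proof -
    obtain C where C: "C \<in> \<B>" "x \<in> C" "C \<subseteq> S" using \<B>(3)[OF S(1)] S(3) by auto
    then have "K \<inter> C \<noteq> {}" using S by auto
    then show ?thesis using pick[of C] C by (auto simp: D_def)
  qed
  have "{\<omega> \<in> space M. \<exists>x\<in>K. F \<omega> x = 0}
      = {\<omega> \<in> space M. \<forall>m::nat. \<exists>d\<in>D. F \<omega> d < 1 / Suc m}"
  proof (intro Collect_cong conj_cong refl iffI)
    fix \<omega> assume \<omega>: "\<omega> \<in> space M" and "\<exists>x\<in>K. F \<omega> x = 0"
    then obtain x where x: "x \<in> K" "F \<omega> x = 0" by auto
    show "\<forall>m::nat. \<exists>d\<in>D. F \<omega> d < 1 / Suc m"
    proof
      fix m :: nat
      have "open {y. F \<omega> y < 1 / Suc m}"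
        using cont[OF \<omega>] by (intro open_Collect_less) auto
      from dense[OF this x(1)] x(2) show "\<exists>d\<in>D. F \<omega> d < 1 / Suc m" by simp
    qed
  next
    fix \<omega> assume \<omega>: "\<omega> \<in> space M" and *: "\<forall>m::nat. \<exists>d\<in>D. F \<omega> d < 1 / Suc m"
    then have "K \<noteq> {}" using D by blast
    then obtain x where x: "x \<in> K" "\<And>y. y \<in> K \<Longrightarrow> F \<omega> x \<le> F \<omega> y"
      using continuous_attains_inf[OF K, of "F \<omega>"] cont[OF \<omega>] continuous_on_subset by blast
    have "F \<omega> x \<le> 0"
    proof (rule ccontr)
      assume "\<not> F \<omega> x \<le> 0"
      then obtain m :: nat where "1 / Suc m < F \<omega> x"
        using nat_approx_posE[of "F \<omega> x"] by auto
      moreover obtain d where "d \<in> D" "F \<omega> d < 1 / Suc m" using * by auto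
      ultimately show False using x(2)[of d] D by auto
    qed
    then show "\<exists>x\<in>K. F \<omega> x = 0" using x(1) nonneg[of \<omega> x] by (intro bexI[of _ x]) auto
  qed
  also have "\<dots> \<in> sets M"
    using meas D(1) by measurable
  finally show ?thesis .
qed

section \<open>Enumerations of roots as solutions of equations\<close>

lemma enumerates_proots_iff:
  fixes p :: "complex poly"
  assumes "p \<noteq> 0"
  shows "enumerates n z (proots p) \<longleftrightarrow> p = smult (lead_coeff p) (\<Prod>k=1..n. [:- z k, 1:])"
proof
  assume "enumerates n z (proots p)"
  then have "proots p = image_mset z (mset_set {1..n})" by (simp add: enumerates_def)
  then have "(\<Prod>x\<in>#proots p. [:- x, 1:]) = (\<Prod>k=1..n. [:- z k, 1:])"
    by (simp add: prod_unfold_prod_mset multiset.map_comp comp_def)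
  then show "p = smult (lead_coeff p) (\<Prod>k=1..n. [:- z k, 1:])"
    using complex_poly_decompose_multiset[of p] by simp
next
  assume p: "p = smult (lead_coeff p) (\<Prod>k=1..n. [:- z k, 1:])"
  have "proots p = proots (\<Prod>k=1..n. [:- z k, 1:])"
    using assms by (subst p) simp
  also have "\<dots> = (\<Sum>k=1..n. {#z k#})"
    by (subst proots_prod) auto
  also have "\<dots> = image_mset z (mset_set {1..n})"
    by (simp add: sum_unfold_sum_mset)
  finally show "enumerates n z (proots p)" by (simp add: enumerates_def)
qed

text \<open>Polynomials of degree at most \<open>n\<close> coincide if they agree at the n + 1
  points 0, ..., n. Being an enumeration thus becomes finitely many equations, continuous in
  \<open>z\<close>.\<close>

lemma enumerates_proots_iff_poly_eq:
  fixes p :: "complex poly"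
  assumes "degree p = n" "p \<noteq> 0"
  shows "enumerates n z (proots p) \<longleftrightarrow>
    (\<forall>i\<le>n. poly p (of_nat i) = lead_coeff p * (\<Prod>k=1..n. of_nat i - z k))"
proof -
  define q where "q = smult (lead_coeff p) (\<Prod>k=1..n. [:- z k, 1:])"
  have "degree (\<Prod>k=1..n. [:- z k, 1:]) = n"
    by (subst degree_prod_sum_eq) auto
  then have deg: "degree q \<le> n" by (simp add: q_def)
  have pq: "poly q x = lead_coeff p * (\<Prod>k=1..n. x - z k)" for x
    by (simp add: q_def poly_prod)
  have "p = q" if "\<forall>i\<le>n. poly p (of_nat i) = poly q (of_nat i)"
  proof (rule poly_eqI_degree)
    show "poly p x = poly q x" if "x \<in> of_nat ` {..n}" for x
      using that \<open>\<forall>i\<le>n. _\<close> by auto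
    have "card (of_nat ` {..n} :: complex set) = Suc n"
      by (subst card_image) (auto simp: inj_on_def)
    then show "degree p < card (of_nat ` {..n} :: complex set)" "degree q < card (of_nat ` {..n} :: complex set)"
      using deg assms by auto
  qed
  then show ?thesis
    unfolding enumerates_proots_iff[OF assms(2)] q_def[symmetric] pq[symmetric] by auto
qed

text \<open>Two enumerations of one multiset differ by a permutation, which is applied to
  \<open>z'\<close> as well. Hence whether a close enumeration exists does not depend on the choice
  of \<open>w\<close>, and \<open>w\<close> may be replaced by an existential quantifier.\<close>

lemma enumerates_reindex:
  assumes "enumerates n w A" "enumerates n w' A" "enumerates n z' C"
    and close: "\<And>k. k \<in> {1..n} \<Longrightarrow> R (z' k) (w' k)"
  obtains z where "enumerates n z C" "\<And>k. k \<in> {1..n} \<Longrightarrow> R (z k) (w k)"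
proof -
  have "image_mset w (mset_set {1..n}) = image_mset w' (mset_set {1..n})"
    using assms by (simp add: enumerates_def)
  then obtain p where p: "p permutes {1..n}" "\<forall>k\<in>{1..n}. w k = w' (p k)"
    using image_mset_eq_implies_permutes[of "{1..n}" w w'] by blast
  have "image_mset (z' \<circ> p) (mset_set {1..n}) = image_mset z' (image_mset p (mset_set {1..n}))"
    by (simp add: multiset.map_comp)
  also have "\<dots> = C" using assms(3) by (simp only: permutes_image_mset[OF p(1)] enumerates_def)
  finally have "enumerates n (z' \<circ> p) C" by (simp add: enumerates_def)
  moreover have "R ((z' \<circ> p) k) (w k)" if "k \<in> {1..n}" for k
    using close[of "p k"] p that permutes_in_image[OF p(1)] by simp
  ultimately show ?thesis using that by blast
qed

lemma enumerates_cong: "(\<And>k. k \<in> {1..n} \<Longrightarrow> z k = z' k) \<Longrightarrow> enumerates n z A \<longleftrightarrow> enumerates n z' A"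
  unfolding enumerates_def by (subst image_mset_cong[of _ z z']) auto

lemma measurable_max_index:
  assumes "\<And>k. (\<lambda>\<omega>. a \<omega> k) \<in> borel_measurable M"
  shows "(\<lambda>\<omega>. max_index n (a \<omega>)) \<in> measurable M (count_space UNIV)"
proof -
  note [measurable] = assms
  show ?thesis unfolding max_index_def by measurable
qed

section \<open>The two binomial equations as one monic polynomial\<close>

text \<open>For \<open>m = 0\<close> the constant \<open>1 + c\<close> is replaced by 1: neither
  contributes roots, and the leading coefficient is 1 in every case.\<close>

definition monic_binomial :: "nat \<Rightarrow> complex \<Rightarrow> complex poly" where
  "monic_binomial m c = (if m = 0 then 1 else monom 1 m + [:c:])"

lemma poly_monic_binomial: "poly (monic_binomial m c) x = (if m = 0 then 1 else x ^ m + c)"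
  by (simp add: monic_binomial_def poly_monom)

lemma degree_monic_binomial: "degree (monic_binomial m c) = m"
  by (cases "m = 0")
    (simp_all add: monic_binomial_def degree_add_eq_left degree_monom_eq)

lemma lead_coeff_monic_binomial: "lead_coeff (monic_binomial m c) = 1"
  unfolding degree_monic_binomial
  by (simp add: monic_binomial_def coeff_pCons split: nat.splits)

lemma monic_binomial_nonzero: "monic_binomial m c \<noteq> 0"
  using lead_coeff_monic_binomial[of m c] by auto

lemma proots_monic_binomial: "proots (monic_binomial m c) = proots (monom 1 m + [:c:])"
  by (cases "m = 0") (simp_all add: monic_binomial_def monom_0)

text \<open>The index \<open>t\<close> is a separate argument, so that measurability can be checked
  for each fixed \<open>t\<close> before the random index is inserted.\<close>

definition binomial_poly :: "nat \<Rightarrow> (nat \<Rightarrow> complex) \<Rightarrow> nat \<Rightarrow> complex poly" where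
  "binomial_poly n a t = monic_binomial t (a 0 / a t) * monic_binomial (n - t) (a t / a n)"

lemma lead_coeff_binomial_poly: "lead_coeff (binomial_poly n a t) = 1"
  by (simp only: binomial_poly_def lead_coeff_mult lead_coeff_monic_binomial mult_1)

lemma degree_binomial_poly: "t \<le> n \<Longrightarrow> degree (binomial_poly n a t) = n"
  by (simp add: binomial_poly_def degree_mult_eq monic_binomial_nonzero degree_monic_binomial)

lemma proots_binomial_poly: "proots (binomial_poly n a (max_index n a)) = binomial_roots n a"
  by (simp add: binomial_poly_def binomial_roots_def Let_def proots_mult monic_binomial_nonzero
      proots_monic_binomial)

text \<open>Tychonoff. An enumeration is a function on all of \<open>nat\<close>; fixing the
  irrelevant coordinates at 0 makes the range of candidates compact.\<close>

lemma compact_supported_cball: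
  "compact {z :: nat \<Rightarrow> complex. \<forall>k. z k \<in> (if k \<in> I then cball 0 r else {0})}"
proof -
  have "{z :: nat \<Rightarrow> complex. \<forall>k. z k \<in> (if k \<in> I then cball 0 r else {0})}
      = PiE UNIV (\<lambda>k. if k \<in> I then cball 0 r else {0})"
    by (auto simp: PiE_def Pi_def)
  moreover have "compactin (product_topology (\<lambda>_. euclidean) UNIV) (PiE UNIV (\<lambda>k. if k \<in> I then cball 0 r else {0::complex}))"
    unfolding compactin_PiE by auto
  ultimately show ?thesis
    by (simp add: euclidean_product_topology)
qed

lemma sets_Collect_roots_close:
  fixes a w :: "'a \<Rightarrow> nat \<Rightarrow> complex" and \<epsilon> :: real
  assumes meas [measurable]: "\<And>k. (\<lambda>\<omega>. a \<omega> k) \<in> borel_measurable M"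
    and n: "n \<ge> 1"
    and w: "\<And>\<omega>. \<omega> \<in> space M \<Longrightarrow> enumerates n (w \<omega>) (binomial_roots n (a \<omega>))"
  shows "{\<omega> \<in> space M. \<exists>z. enumerates n z (proots (coeff_poly n (a \<omega>))) \<and>
    (\<forall>k\<in>{1..n}. norm (z k - w \<omega> k) < \<epsilon> / n * norm (w \<omega> k))} \<in> sets M" (is "?E \<in> _")
proof -
  define t where "t \<omega> = max_index n (a \<omega>)" for \<omega>
  \<comment> \<open>\<open>H1\<close> vanishes exactly at the enumerations of the roots of the
    random polynomial when \<open>a \<omega> n \<noteq> 0\<close>, and \<open>H2\<close> exactly at
    those of the binomial roots.\<close>
  define H1 where "H1 \<omega> x = (\<Sum>i\<le>n. norm (poly (coeff_poly n (a \<omega>)) (of_nat i) -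
      a \<omega> n * (\<Prod>k=1..n. of_nat i - x k)))" for \<omega> x
  define H2 where "H2 \<omega> y = (\<Sum>i\<le>n. norm (poly (binomial_poly n (a \<omega>) (t \<omega>)) (of_nat i) -
      (\<Prod>k=1..n. of_nat i - y k)))" for \<omega> y
  define H where "H \<omega> x = H1 \<omega> (fst x) + H2 \<omega> (snd x)" for \<omega> and x :: "(nat \<Rightarrow> complex) \<times> (nat \<Rightarrow> complex)"
  define S where "S j = {z :: nat \<Rightarrow> complex. \<forall>k. z k \<in> (if k \<in> {1..n} then cball 0 (real j) else {0})}" for j
  \<comment> \<open>The strict inequality is an open condition; the slack 1/(j+1) makes it closed,
    and the union over \<open>j\<close> recovers it.\<close>
  define K where "K j = (S j \<times> S j) \<inter>
    (\<Inter>k\<in>{1..n}. {x. norm (fst x k - snd x k) + 1 / Suc j \<le> \<epsilon> / n * norm (snd x k)})" for j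
  have H1_0: "H1 \<omega> x = 0 \<longleftrightarrow> enumerates n x (proots (coeff_poly n (a \<omega>)))" if "a \<omega> n \<noteq> 0" for \<omega> x
  proof -
    have d: "degree (coeff_poly n (a \<omega>)) = n" using that by (rule degree_coeff_poly)
    then have "coeff_poly n (a \<omega>) \<noteq> 0" using n by auto
    from enumerates_proots_iff_poly_eq[OF d this] show ?thesis
      by (simp add: H1_def sum_nonneg_eq_0_iff d coeff_coeff_poly Ball_def)
  qed
  have H2_0: "H2 \<omega> x = 0 \<longleftrightarrow> enumerates n x (binomial_roots n (a \<omega>))" for \<omega> x
  proof -
    have tn: "t \<omega> \<le> n" by (simp add: t_def max_index_le)
    have d: "degree (binomial_poly n (a \<omega>) (t \<omega>)) = n" using tn by (rule degree_binomial_poly)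
    then have "binomial_poly n (a \<omega>) (t \<omega>) \<noteq> 0" using n by auto
    from enumerates_proots_iff_poly_eq[OF d this] show ?thesis
      unfolding lead_coeff_binomial_poly proots_binomial_poly[of n "a \<omega>", folded t_def]
      by (simp add: H2_def sum_nonneg_eq_0_iff Ball_def)
  qed
  have nonneg: "H1 \<omega> x \<ge> 0" "H2 \<omega> x \<ge> 0" for \<omega> x
    by (auto simp: H1_def H2_def intro!: sum_nonneg)
  have [measurable]: "t \<in> measurable M (count_space UNIV)"
    unfolding t_def using meas by (rule measurable_max_index)
  have m1 [measurable]: "(\<lambda>\<omega>. H1 \<omega> x) \<in> borel_measurable M" for x
    unfolding H1_def poly_coeff_poly by measurable
  have m2 [measurable]: "(\<lambda>\<omega>. H2 \<omega> x) \<in> borel_measurable M" for x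
  proof -
    have "(\<lambda>\<omega>. poly (binomial_poly n (a \<omega>) (t \<omega>)) c) \<in> borel_measurable M" for c
    \<comment> \<open>The random index takes only countably many values.\<close>
    proof (rule measurable_compose_countable[of "\<lambda>s \<omega>. poly (binomial_poly n (a \<omega>) s) c" M borel t])
      fix s
      show "(\<lambda>\<omega>. poly (binomial_poly n (a \<omega>) s) c) \<in> borel_measurable M"
        unfolding binomial_poly_def by (simp add: poly_monic_binomial)
    qed measurable
    note [measurable] = this
    show ?thesis unfolding H2_def by measurable
  qed
  have coord: "continuous_on UNIV (\<lambda>x :: (nat \<Rightarrow> complex) \<times> (nat \<Rightarrow> complex). fst x k)"
    "continuous_on UNIV (\<lambda>x :: (nat \<Rightarrow> complex) \<times> (nat \<Rightarrow> complex). snd x k)" for k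
    by (rule continuous_on_product_then_coordinatewise[OF continuous_on_fst[OF continuous_on_id]]
        continuous_on_product_then_coordinatewise[OF continuous_on_snd[OF continuous_on_id]])+
  have cont: "continuous_on UNIV (H \<omega>)" for \<omega>
    unfolding H_def H1_def H2_def by (intro continuous_intros coord)
  have "compact (K j)" for j
    unfolding K_def
  proof (rule compact_Int_closed)
    show "compact (S j \<times> S j)"
      unfolding S_def by (intro compact_Times compact_supported_cball)
    show "closed (\<Inter>k\<in>{1..n}. {x :: (nat \<Rightarrow> complex) \<times> (nat \<Rightarrow> complex).
        norm (fst x k - snd x k) + 1 / Suc j \<le> \<epsilon> / n * norm (snd x k)})"
      by (intro closed_INT ballI closed_Collect_le continuous_intros coord)
  qed
  then have *: "{\<omega> \<in> space M. \<exists>x\<in>K j. H \<omega> x = 0} \<in> sets M" for j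
  proof (rule sets_Collect_ex_zero_on_compact)
    show "(\<lambda>\<omega>. H \<omega> x) \<in> borel_measurable M" for x unfolding H_def by measurable
  qed (use cont nonneg in \<open>auto simp: H_def[abs_def]\<close>)
  have "?E = {\<omega> \<in> space M. a \<omega> n \<noteq> 0} \<inter> (\<Union>j. {\<omega> \<in> space M. \<exists>x\<in>K j. H \<omega> x = 0})"
  proof (intro equalityI subsetI)
    fix \<omega> assume "\<omega> \<in> ?E"
    then obtain z where \<omega>: "\<omega> \<in> space M" and z: "enumerates n z (proots (coeff_poly n (a \<omega>)))"
      "\<And>k. k \<in> {1..n} \<Longrightarrow> norm (z k - w \<omega> k) < \<epsilon> / n * norm (w \<omega> k)" by auto
    \<comment> \<open>Having \<open>n\<close> roots forces degree \<open>n\<close>, so the event is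
      empty where \<open>a \<omega> n = 0\<close>.\<close>
    have "size (proots (coeff_poly n (a \<omega>))) = n"
      using z(1) unfolding enumerates_def by (metis card_atLeastAtMost diff_Suc_1 size_image_mset size_mset_set)
    then have deg: "degree (coeff_poly n (a \<omega>)) = n" by (simp add: size_proots_complex)
    then have an: "a \<omega> n \<noteq> 0"
      using n by (metis coeff_coeff_poly degree_0 le_refl leading_coeff_0_iff not_one_le_zero)
    define z' where "z' k = (if k \<in> {1..n} then z k else 0)" for k
    define w' where "w' k = (if k \<in> {1..n} then w \<omega> k else 0)" for k
    have "H1 \<omega> z' = 0" using z(1) enumerates_cong[of n z z'] by (simp add: H1_0[OF an] z'_def)
    moreover have "H2 \<omega> w' = 0" using w[OF \<omega>] enumerates_cong[of n "w \<omega>" w'] by (simp add: H2_0 w'_def)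
    ultimately have H: "H \<omega> (z', w') = 0" by (simp add: H_def)
    have "\<forall>k\<in>{1..n}. eventually (\<lambda>j. norm (z k) \<le> real j \<and> norm (w \<omega> k) \<le> real j \<and>
        norm (z k - w \<omega> k) + 1 / Suc j \<le> \<epsilon> / n * norm (w \<omega> k)) sequentially"
    proof
      fix k assume k: "k \<in> {1..n}"
      have "eventually (\<lambda>j. 1 / Suc j < \<epsilon> / n * norm (w \<omega> k) - norm (z k - w \<omega> k)) sequentially"
        using z(2)[OF k] lim_inverse_n' LIMSEQ_Suc[OF lim_inverse_n'] by (intro order_tendstoD) auto
      moreover have "eventually (\<lambda>j. c \<le> real j) sequentially" for c
        by (rule eventually_sequentiallyI[of "nat \<lceil>c\<rceil>"]) linarith
      note this[of "norm (z k)"] this[of "norm (w \<omega> k)"]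
      ultimately show "eventually (\<lambda>j. norm (z k) \<le> real j \<and> norm (w \<omega> k) \<le> real j \<and>
        norm (z k - w \<omega> k) + 1 / Suc j \<le> \<epsilon> / n * norm (w \<omega> k)) sequentially"
        by eventually_elim auto
    qed
    then have "eventually (\<lambda>j. \<forall>k\<in>{1..n}. norm (z k) \<le> real j \<and> norm (w \<omega> k) \<le> real j \<and>
        norm (z k - w \<omega> k) + 1 / Suc j \<le> \<epsilon> / n * norm (w \<omega> k)) sequentially"
      by (intro eventually_ball_finite) auto
    from eventually_happens'[OF sequentially_bot this]
    obtain j where "\<forall>k\<in>{1..n}. norm (z k) \<le> real j \<and> norm (w \<omega> k) \<le> real j \<and>
        norm (z k - w \<omega> k) + 1 / Suc j \<le> \<epsilon> / n * norm (w \<omega> k)"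
      by blast
    then have "(z', w') \<in> K j" by (auto simp: K_def S_def z'_def w'_def)
    then show "\<omega> \<in> {\<omega> \<in> space M. a \<omega> n \<noteq> 0} \<inter> (\<Union>j. {\<omega> \<in> space M. \<exists>x\<in>K j. H \<omega> x = 0})"
      using H \<omega> an by blast
  next
    fix \<omega> assume "\<omega> \<in> {\<omega> \<in> space M. a \<omega> n \<noteq> 0} \<inter> (\<Union>j. {\<omega> \<in> space M. \<exists>x\<in>K j. H \<omega> x = 0})"
    then obtain j z' w' where \<omega>: "\<omega> \<in> space M" and an: "a \<omega> n \<noteq> 0" and K: "(z', w') \<in> K j"
      and "H \<omega> (z', w') = 0" by auto
    then have "H1 \<omega> z' = 0" "H2 \<omega> w' = 0" using nonneg[of \<omega>] by (auto simp: H_def add_nonneg_eq_0_iff)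
    then have en: "enumerates n z' (proots (coeff_poly n (a \<omega>)))" "enumerates n w' (binomial_roots n (a \<omega>))"
      by (simp_all add: H1_0[OF an] H2_0)
    have "norm (z' k - w' k) < \<epsilon> / n * norm (w' k)" if "k \<in> {1..n}" for k
    proof -
      have "norm (z' k - w' k) + 1 / Suc j \<le> \<epsilon> / n * norm (w' k)" using K that by (auto simp: K_def)
      moreover have "1 / Suc j > (0::real)" by simp
      ultimately show ?thesis by linarith
    qed
    then obtain z where "enumerates n z (proots (coeff_poly n (a \<omega>)))"
      "\<And>k. k \<in> {1..n} \<Longrightarrow> norm (z k - w \<omega> k) < \<epsilon> / n * norm (w \<omega> k)"
      using enumerates_reindex[OF w[OF \<omega>] en(2) en(1), of "\<lambda>z w. norm (z - w) < \<epsilon> / n * norm w"] by blast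
    then show "\<omega> \<in> ?E" using \<omega> by blast
  qed
  also have "\<dots> \<in> sets M" using * by (intro sets.Int sets.countable_UN) auto
  finally show ?thesis .
qed

subsection \<open>The maximum of variables with slowly varying tail\<close>

context prob_space
begin

lemma tail_prob_antimono:
  assumes "X \<in> borel_measurable M" "x \<le> y"
  shows "tail_prob M X y \<le> tail_prob M X x"
  unfolding tail_prob_def using assms by (intro finite_measure_mono) auto

lemma tail_prob_tendsto_0:
  fixes u :: "nat \<Rightarrow> real"
  assumes X [measurable]: "X \<in> borel_measurable M" and u: "incseq u" "filterlim u at_top sequentially"
  shows "(\<lambda>k. tail_prob M X (u k)) \<longlonglongrightarrow> 0"
proof -
  have "(\<lambda>k. prob {\<omega> \<in> space M. X \<omega> > u k}) \<longlonglongrightarrow> prob (\<Inter>k. {\<omega> \<in> space M. X \<omega> > u k})"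
  proof (rule finite_Lim_measure_decseq)
    show "decseq (\<lambda>k. {\<omega> \<in> space M. X \<omega> > u k})"
      using u(1) by (auto simp: decseq_def incseq_def intro: le_less_trans)
  qed auto
  also have "(\<Inter>k. {\<omega> \<in> space M. X \<omega> > u k}) = {}"
  proof -
    have "\<exists>k. \<not> X \<omega> > u k" for \<omega>
      using u(2) by (metis eventually_happens' filterlim_at_top not_less sequentially_bot)
    then show ?thesis by blast
  qed
  finally show ?thesis by (simp add: tail_prob_def)
qed

lemma prob_interval_eq_tail_prob:
  assumes X [measurable]: "X \<in> borel_measurable M" and "x \<le> y"
  shows "prob (X -` {x<..y} \<inter> space M) = tail_prob M X x - tail_prob M X y"
proof -
  have "X -` {x<..y} \<inter> space M = {\<omega> \<in> space M. X \<omega> > x} - {\<omega> \<in> space M. X \<omega> > y}"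
    by auto
  moreover have "{\<omega> \<in> space M. X \<omega> > y} \<subseteq> {\<omega> \<in> space M. X \<omega> > x}"
    using assms(2) by auto
  ultimately show ?thesis
    unfolding tail_prob_def by (simp add: finite_measure_Diff)
qed

lemma prob_le_eq_tail_prob:
  assumes X [measurable]: "X \<in> borel_measurable M"
  shows "prob (X -` {..x} \<inter> space M) = 1 - tail_prob M X x"
proof -
  have "X -` {..x} \<inter> space M = space M - {\<omega> \<in> space M. X \<omega> > x}"
    by auto
  then show ?thesis
    unfolding tail_prob_def by (simp add: prob_compl)
qed

text \<open>
  With \<open>X i\<close> in the dyadic band \<open>(2^k, 2^(k+1)]\<close>, a comparable \<open>X j\<close> lies in
  \<open>(2^(k-1), 2^(k+1)]\<close>; the sum over \<open>k\<close> of the probabilities of the first band telescopes.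
\<close>

lemma prob_comparable_pair_le:
  fixes X :: "nat \<Rightarrow> 'a \<Rightarrow> real"
  assumes indep: "indep_vars (\<lambda>_. borel) X UNIV"
    and tail: "\<And>i x. tail_prob M (X i) x = T x"
    and ij: "i \<noteq> j"
    and gap: "\<And>k. k \<ge> m \<Longrightarrow> T (2 ^ k) - T (2 ^ (k + 2)) \<le> C"
  shows "prob {\<omega> \<in> space M. X i \<omega> > 2 ^ (m + 1) \<and> X i \<omega> \<le> 2 * X j \<omega> \<and> X j \<omega> \<le> X i \<omega>}
    \<le> C * T (2 ^ (m + 1))"
proof -
  have X [measurable]: "X i \<in> borel_measurable M" for i
    using indep by (simp add: indep_vars_def)
  \<comment> \<open>Written as an intersection over the index set \<open>{i,j}\<close> so that the
    product formula for independent variables applies.\<close>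
  define A where "A k = (\<Inter>l\<in>{i,j}. X l -` (if l = i then {2 ^ (m + 1 + k)<..2 ^ (m + 2 + k)} else {2 ^ (m + k)<..2 ^ (m + 2 + k)}) \<inter> space M)" for k
  define p where "p k = T (2 ^ (m + 1 + k)) - T (2 ^ (m + 1 + Suc k))" for k
  have A_sets [measurable]: "A k \<in> sets M" for k
    unfolding A_def by (intro sets.finite_INT measurable_sets[OF X]) simp_all
  have T_anti: "T y \<le> T x" if "x \<le> y" for x y
    using tail_prob_antimono[OF X[of 0] that] by (simp add: tail)
  have p0: "p k \<ge> 0" for k
    unfolding p_def using T_anti[of "2 ^ (m + 1 + k)" "2 ^ (m + 1 + Suc k)"] by simp
  have A: "prob (A k) \<le> C * p k" for k
  proof -
    have "prob (A k) = (\<Prod>l\<in>{i,j}. prob (X l -` (if l = i then {2 ^ (m + 1 + k)<..2 ^ (m + 2 + k)} else {2 ^ (m + k)<..2 ^ (m + 2 + k)}) \<inter> space M))"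
      unfolding A_def by (rule indep_varsD[OF indep]) simp_all
    also have "\<dots> = p k * (T (2 ^ (m + k)) - T (2 ^ (m + k + 2)))"
      using ij by (simp add: prob_interval_eq_tail_prob tail p_def add.commute add.left_commute)
    \<comment> \<open>The band for \<open>X j\<close> spans two dyadic steps, which is the
      difference bounded by \<open>gap\<close>.\<close>
    also have "\<dots> \<le> p k * C"
      using gap[of "m + k"] p0[of k] by (intro mult_left_mono) auto
    finally show ?thesis by (simp add: mult.commute)
  qed
  have "(\<lambda>k. T (2 ^ (m + 1 + k))) \<longlonglongrightarrow> 0"
  proof -
    have "(\<lambda>k. tail_prob M (X 0) (2 ^ (m + 1 + k))) \<longlonglongrightarrow> 0"
    proof (rule tail_prob_tendsto_0)
      show "incseq (\<lambda>k. 2 ^ (m + 1 + k) :: real)"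
        by (intro incseq_SucI) simp
      show "filterlim (\<lambda>k. 2 ^ (m + 1 + k) :: real) at_top sequentially"
        by real_asymp
    qed simp
    then show ?thesis by (simp add: tail)
  qed
  from telescope_sums'[OF this] have p_sums: "p sums T (2 ^ (m + 1))"
    by (simp add: p_def[abs_def])
  then have Cp_sums: "(\<lambda>k. C * p k) sums (C * T (2 ^ (m + 1)))"
    by (rule sums_mult)
  have A_summable: "summable (\<lambda>k. prob (A k))"
    by (rule summable_comparison_test'[OF sums_summable[OF Cp_sums], of 0]) (simp add: A)
  have "{\<omega> \<in> space M. X i \<omega> > 2 ^ (m + 1) \<and> X i \<omega> \<le> 2 * X j \<omega> \<and> X j \<omega> \<le> X i \<omega>} \<subseteq> (\<Union>k. A k)"
  proof
    fix \<omega> assume "\<omega> \<in> {\<omega> \<in> space M. X i \<omega> > 2 ^ (m + 1) \<and> X i \<omega> \<le> 2 * X j \<omega> \<and> X j \<omega> \<le> X i \<omega>}"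
    then have \<omega>: "\<omega> \<in> space M" "X i \<omega> > 2 ^ (m + 1)" "X i \<omega> \<le> 2 * X j \<omega>" "X j \<omega> \<le> X i \<omega>" by auto
    have "filterlim (\<lambda>k. 2 ^ (m + 2 + k) :: real) at_top sequentially"
      by real_asymp
    then have ex: "\<exists>k. X i \<omega> \<le> 2 ^ (m + 2 + k)"
      by (metis (no_types, lifting) eventually_happens' filterlim_at_top sequentially_bot)
    define k where "k = (LEAST k. X i \<omega> \<le> 2 ^ (m + 2 + k))"
    have up: "X i \<omega> \<le> 2 ^ (m + 2 + k)" unfolding k_def using ex by (rule LeastI_ex)
    have low: "X i \<omega> > 2 ^ (m + 1 + k)"
    proof (cases k)
      case 0
      then show ?thesis using \<omega>(2) by simp
    next
      case (Suc l)
      then have "l < k" by simp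
      then have "\<not> X i \<omega> \<le> 2 ^ (m + 2 + l)" unfolding k_def by (rule not_less_Least)
      then show ?thesis by (simp add: Suc)
    qed
    then have "2 ^ (m + k) < X j \<omega>" using \<omega>(3) by simp
    then have "\<omega> \<in> A k" using up low \<omega> by (auto simp: A_def)
    then show "\<omega> \<in> (\<Union>k. A k)" by blast
  qed
  then have "prob {\<omega> \<in> space M. X i \<omega> > 2 ^ (m + 1) \<and> X i \<omega> \<le> 2 * X j \<omega> \<and> X j \<omega> \<le> X i \<omega>} \<le> prob (\<Union>k. A k)"
    by (intro finite_measure_mono) auto
  also have "\<dots> \<le> (\<Sum>k. prob (A k))"
    using A_summable by (intro finite_measure_subadditive_countably) auto
  also have "\<dots> \<le> (\<Sum>k. C * p k)"
    using A_summable sums_summable[OF Cp_sums] A by (intro suminf_le) auto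
  also have "\<dots> = C * T (2 ^ (m + 1))" using Cp_sums by (simp add: sums_iff)
  finally show ?thesis .
qed

text \<open>Take a dyadic level y whose tail probability lies between K/n and 2K/n. Then all values
  stay below y with probability at most exp(-K), while slow variation makes a pair above y within a
  factor 2 of each other unlikely: each of at most (2n)^2 pairs costs 16 \<eta> K^2 / n^2 with a
  small \<eta>.\<close>

lemma eventually_dominant_value:
  fixes X :: "nat \<Rightarrow> 'a \<Rightarrow> real"
  assumes indep: "indep_vars (\<lambda>_. borel) X UNIV"
    and tail: "\<And>i x. tail_prob M (X i) x = tail_prob M (X 0) x"
    and slow: "slowly_varying_tail M (X 0)"
    and \<delta>: "\<delta> > 0"
  obtains c where "c > 0"
    "eventually (\<lambda>n. prob {\<omega> \<in> space M. \<exists>i\<le>n. X i \<omega> > c * real n \<and> (\<forall>j\<le>n. j \<noteq> i \<longrightarrow> 2 * X j \<omega> < X i \<omega>)} \<ge> 1 - \<delta>) sequentially"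
proof -
  define T where "T = tail_prob M (X 0)"
  have tail': "tail_prob M (X i) x = T x" for i x using tail by (simp add: T_def)
  have X [measurable]: "X i \<in> borel_measurable M" for i
    using indep by (simp add: indep_vars_def)
  have T_anti: "T y \<le> T x" if "x \<le> y" for x y
    using tail_prob_antimono[OF X[of 0] that] by (simp add: T_def)
  define f where "f k = T (2 ^ k)" for k
  have f_pos: "f k > 0" for k
    using slow by (simp add: f_def T_def slowly_varying_tail_def)
  have f_anti: "f l \<le> f k" if "k \<le> l" for k l
    unfolding f_def using that by (intro T_anti power_increasing) auto
  have f_0: "f \<longlonglongrightarrow> 0"
    unfolding f_def T_def
  proof (rule tail_prob_tendsto_0)
    show "incseq (\<lambda>k. 2 ^ k :: real)" by (intro incseq_SucI) simp
    show "filterlim (\<lambda>k. 2 ^ k :: real) at_top sequentially" by real_asymp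
  qed simp
  have f_ratio: "(\<lambda>k. f (Suc k) / f k) \<longlonglongrightarrow> 1"
  proof -
    have "((\<lambda>x. T (2 * x) / T x) \<longlongrightarrow> 1) at_top"
      using slow by (simp add: slowly_varying_tail_def T_def)
    moreover have "filterlim (\<lambda>k. 2 ^ k :: real) at_top sequentially" by real_asymp
    ultimately have "(\<lambda>k. T (2 * 2 ^ k) / T (2 ^ k)) \<longlonglongrightarrow> 1"
      by (rule filterlim_compose)
    then show ?thesis by (simp add: f_def)
  qed
  define K where "K = max 1 (- ln (\<delta> / 2))"
  have K: "K \<ge> 1" "exp (- K) \<le> \<delta> / 2"
  proof -
    show "K \<ge> 1" by (simp add: K_def)
    have "- K \<le> ln (\<delta> / 2)" by (simp add: K_def)
    then have "exp (- K) \<le> exp (ln (\<delta> / 2))" by (simp only: exp_le_cancel_iff)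
    then show "exp (- K) \<le> \<delta> / 2" using \<delta> by simp
  qed
  \<comment> \<open>The second entry makes the total cost 64 \<eta> K^2 of the pairs at most
    \<delta>/2; the first lets one dyadic step at most halve the tail.\<close>
  define \<eta> where "\<eta> = min (1 / 2) (\<delta> / (128 * K\<^sup>2))"
  have \<eta>: "0 < \<eta>" "\<eta> \<le> 1 / 2" "64 * \<eta> * K\<^sup>2 \<le> \<delta> / 2"
  proof -
    have "\<eta> \<le> \<delta> / (128 * K\<^sup>2)" by (simp add: \<eta>_def)
    then have "64 * \<eta> * K\<^sup>2 \<le> 64 * (\<delta> / (128 * K\<^sup>2)) * K\<^sup>2" by (intro mult_right_mono mult_left_mono) auto
    also have "\<dots> = \<delta> / 2" using K by simp
    finally show "64 * \<eta> * K\<^sup>2 \<le> \<delta> / 2" .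
  qed (use \<delta> K in \<open>auto simp: \<eta>_def\<close>)
  have "eventually (\<lambda>k. f (Suc k) / f k > 1 - \<eta>) sequentially"
    using f_ratio \<eta> by (intro order_tendstoD) auto
  then obtain k0 where k0: "\<And>k. k \<ge> k0 \<Longrightarrow> f (Suc k) > (1 - \<eta>) * f k"
    by (auto simp: eventually_sequentially pos_less_divide_eq f_pos)
  have half: "f k \<le> 2 * f (Suc k)" if "k \<ge> k0" for k
  proof -
    have "1 / 2 * f k \<le> (1 - \<eta>) * f k" using \<eta> f_pos[of k] by (intro mult_right_mono) auto
    then show ?thesis using k0[OF that] by simp
  qed
  \<comment> \<open>Each of the two dyadic steps loses at most a fraction \<eta> of the
    tail.\<close>
  have gap: "f k - f (k + 2) \<le> 2 * \<eta> * f k" if "k \<ge> k0" for k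
  proof -
    have "\<eta> * f (Suc k) \<le> \<eta> * f k" using \<eta> f_anti[of k "Suc k"] by (intro mult_left_mono) auto
    then show ?thesis using k0[of k] k0[of "Suc k"] that by (simp add: algebra_simps)
  qed
  \<comment> \<open>Along powers of 2 the tail decays no faster than 1/x, so a level with tail of
    order 1/n is at least of order n.\<close>
  have lower: "f k0 \<le> 2 ^ m * f (k0 + m)" for m
  proof (induction m)
    case (Suc m)
    have "2 ^ m * f (k0 + m) \<le> 2 ^ m * (2 * f (k0 + Suc m))"
      using half[of "k0 + m"] by (intro mult_left_mono) auto
    also have "\<dots> = 2 ^ Suc m * f (k0 + Suc m)" by simp
    finally show ?case using Suc.IH by linarith
  qed simp
  define c where "c = f k0 * 2 ^ k0 / (2 * K)"
  have c: "c > 0" using f_pos K by (simp add: c_def)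
  \<comment> \<open>For such \<open>n\<close> the level chosen below lies in the range where
    \<open>half\<close> and \<open>gap\<close> hold.\<close>
  have "eventually (\<lambda>n. K / real n < f (k0 + 2)) sequentially"
  proof (rule order_tendstoD)
    show "(\<lambda>n. K / real n) \<longlonglongrightarrow> 0" by real_asymp
  qed (rule f_pos)
  then have ev: "eventually (\<lambda>n. n \<ge> 1 \<and> K / real n < f (k0 + 2)) sequentially"
    using eventually_ge_at_top[of 1] by eventually_elim auto
  have main: "prob {\<omega> \<in> space M. \<exists>i\<le>n. X i \<omega> > c * real n \<and> (\<forall>j\<le>n. j \<noteq> i \<longrightarrow> 2 * X j \<omega> < X i \<omega>)} \<ge> 1 - \<delta>"
    (is "prob ?G \<ge> _") if n: "n \<ge> 1" "K / real n < f (k0 + 2)" for n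
  proof -
    have "eventually (\<lambda>k. f k < K / real n) sequentially"
      using f_0 K n by (intro order_tendstoD) auto
    then have ex: "\<exists>k. f k \<le> K / real n"
      by (metis eventually_happens' less_imp_le sequentially_bot)
    \<comment> \<open>Minimality gives \<open>f (k - 1) > K / n\<close>, and going back one and two
      steps with \<open>half\<close> bounds the tails there by 2K/n and 4K/n. The level
      \<open>y\<close> has exponent k - 1 = m + 1.\<close>
    define k where "k = (LEAST k. f k \<le> K / real n)"
    have fk: "f k \<le> K / real n" unfolding k_def using ex by (rule LeastI_ex)
    have "k > k0 + 2"
    proof (rule ccontr)
      assume "\<not> k > k0 + 2"
      then have "f (k0 + 2) \<le> f k" by (intro f_anti) auto
      then show False using fk n by linarith
    qed
    then obtain m where m: "k = m + 2" "m \<ge> k0"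
      by (metis add.commute add_leD2 le_add_diff_inverse less_imp_le_nat nat_add_left_cancel_le)
    define y :: real where "y = 2 ^ (m + 1)"
    have fy: "f (m + 1) > K / real n"
    proof -
      have "\<not> f (m + 1) \<le> K / real n" by (rule not_less_Least) (simp add: k_def[symmetric] m)
      then show ?thesis by simp
    qed
    have fm1: "f (m + 1) \<le> 2 * (K / real n)" and fm: "f m \<le> 4 * (K / real n)"
      using half[of "m + 1"] half[of m] fk m by simp_all
    \<comment> \<open>Since 2^k = 2y, \<open>lower\<close> gives f(k0) 2^k0 \<le> 2yK/n; the value
      of \<open>c\<close> is read off from this.\<close>
    have y_ge: "y \<ge> c * real n"
    proof -
      have "f k0 \<le> 2 ^ (k - k0) * f k" using lower[of "k - k0"] m by simp
      also have "\<dots> \<le> 2 ^ (k - k0) * (K / real n)" using fk by (intro mult_left_mono) auto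
      finally have "f k0 * 2 ^ k0 \<le> 2 ^ (k - k0) * (K / real n) * 2 ^ k0" by (intro mult_right_mono) auto
      also have "\<dots> = 2 ^ k * (K / real n)" using m by (simp flip: power_add)
      also have "\<dots> = 2 * y * K / real n" by (simp add: m y_def)
      finally show ?thesis using K n by (simp add: c_def field_simps)
    qed
    define P where "P i j = {\<omega> \<in> space M. X i \<omega> > y \<and> X i \<omega> \<le> 2 * X j \<omega> \<and> X j \<omega> \<le> X i \<omega>}" for i j
    define I where "I = {(i, j). i \<le> n \<and> j \<le> n \<and> i \<noteq> j}"
    define L where "L = (\<Inter>i\<in>{..n}. X i -` {..y} \<inter> space M)"
    have I: "finite I" "card I \<le> (n + 1)\<^sup>2"
    proof -
      have sub: "I \<subseteq> {..n} \<times> {..n}" by (auto simp: I_def)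
      then show "finite I" by (rule finite_subset) auto
      have "card I \<le> card ({..n} \<times> {..n})" using sub by (intro card_mono) auto
      then show "card I \<le> (n + 1)\<^sup>2" by (simp add: power2_eq_square)
    qed
    have L_meas [measurable]: "L \<in> sets M" unfolding L_def by measurable
    have P_meas [measurable]: "P i j \<in> sets M" for i j unfolding P_def by measurable
    have L: "prob L \<le> exp (- K)"
    proof -
      have "prob L = (\<Prod>i\<in>{..n}. prob (X i -` {..y} \<inter> space M))"
        unfolding L_def by (rule indep_varsD[OF indep]) auto
      also have "\<dots> = (1 - f (m + 1)) ^ (n + 1)"
        by (simp add: prob_le_eq_tail_prob tail' f_def y_def)
      also have "\<dots> \<le> exp (- (K / real n)) ^ (n + 1)"
      proof (rule power_mono)
        show "1 - f (m + 1) \<le> exp (- (K / real n))"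
          using exp_ge_add_one_self[of "- (K / real n)"] fy by linarith
        show "0 \<le> 1 - f (m + 1)"
          unfolding f_def T_def tail_prob_def by simp
      qed
      also have "\<dots> \<le> exp (- (K / real n)) ^ n"
        using K by (intro power_decreasing) auto
      also have "\<dots> = exp (- K)" using n by (simp flip: exp_of_nat_mult)
      finally show ?thesis .
    qed
    \<comment> \<open>The factors are 2\<eta> * 4K/n for the band of the second variable and 2K/n
      for the first exceeding \<open>y\<close>.\<close>
    have P: "prob (P i j) \<le> 16 * \<eta> * K\<^sup>2 / (real n)\<^sup>2" if "(i, j) \<in> I" for i j
    proof -
      have "prob (P i j) \<le> (2 * \<eta> * f m) * T (2 ^ (m + 1))"
        unfolding P_def y_def
      proof (rule prob_comparable_pair_le[OF indep tail'])
        show "i \<noteq> j" using that by (simp add: I_def)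
        fix l assume l: "l \<ge> m"
        have "T (2 ^ l) - T (2 ^ (l + 2)) \<le> 2 * \<eta> * f l" using gap[of l] l m by (simp add: f_def)
        also have "\<dots> \<le> 2 * \<eta> * f m" using f_anti[OF l] \<eta> by (intro mult_left_mono) auto
        finally show "T (2 ^ l) - T (2 ^ (l + 2)) \<le> 2 * \<eta> * f m" .
      qed
      also have "\<dots> \<le> (2 * \<eta> * (4 * (K / real n))) * (2 * (K / real n))"
        using fm fm1 \<eta> f_pos[of m] f_pos[of "m + 1"] K by (intro mult_mono) (auto simp: f_def)
      also have "\<dots> = 16 * \<eta> * K\<^sup>2 / (real n)\<^sup>2" by (simp add: power2_eq_square)
      finally show ?thesis .
    qed
    have "prob (\<Union>(i, j)\<in>I. P i j) \<le> (\<Sum>(i, j)\<in>I. prob (P i j))"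
      unfolding case_prod_beta by (rule finite_measure_subadditive_finite[OF I(1)]) auto
    also have "\<dots> \<le> (\<Sum>(i, j)\<in>I. 16 * \<eta> * K\<^sup>2 / (real n)\<^sup>2)"
      using P by (intro sum_mono) auto
    also have "\<dots> = real (card I) * (16 * \<eta> * K\<^sup>2 / (real n)\<^sup>2)" by simp
    also have "\<dots> \<le> (2 * real n)\<^sup>2 * (16 * \<eta> * K\<^sup>2 / (real n)\<^sup>2)"
    proof (rule mult_right_mono)
      have "real (card I) \<le> real ((n + 1)\<^sup>2)" using I(2) by (simp only: of_nat_le_iff)
      also have "\<dots> \<le> (2 * real n)\<^sup>2" using n by (simp only: of_nat_power) (intro power_mono, auto)
      finally show "real (card I) \<le> (2 * real n)\<^sup>2" .
    qed (use \<eta> in auto)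
    also have "\<dots> = 64 * \<eta> * K\<^sup>2" using n by (simp add: power2_eq_square)
    finally have PI: "prob (\<Union>(i, j)\<in>I. P i j) \<le> \<delta> / 2" using \<eta> by linarith
    have G_meas [measurable]: "?G \<in> sets M" by measurable
    have PI_meas: "(\<Union>(i, j)\<in>I. P i j) \<in> sets M" using I(1) by (auto intro!: sets.finite_UN)
    \<comment> \<open>Outside \<open>L\<close> the maximum exceeds \<open>y\<close>; if some other
      value were at least half of it, the sample point would lie in some
      \<open>P i j\<close>.\<close>
    have "space M \<subseteq> ?G \<union> (L \<union> (\<Union>(i, j)\<in>I. P i j))"
    proof (intro subsetI, rule ccontr)
      fix \<omega> assume \<omega>: "\<omega> \<in> space M" "\<omega> \<notin> ?G \<union> (L \<union> (\<Union>(i, j)\<in>I. P i j))"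
      have "Max ((\<lambda>i. X i \<omega>) ` {..n}) \<in> (\<lambda>i. X i \<omega>) ` {..n}" by (rule Max_in) auto
      then obtain i where i: "i \<le> n" "X i \<omega> = Max ((\<lambda>i. X i \<omega>) ` {..n})"
        by (metis (no_types, lifting) atMost_iff imageE)
      have max: "X j \<omega> \<le> X i \<omega>" if "j \<le> n" for j
        unfolding i(2) using that by (intro Max_ge) auto
      have "X i \<omega> > y"
      proof (rule ccontr)
        assume "\<not> X i \<omega> > y"
        then have "\<omega> \<in> L" unfolding L_def using max \<omega>(1) by (auto intro: order_trans simp: not_less)
        then show False using \<omega> by auto
      qed
      moreover have "2 * X j \<omega> < X i \<omega>" if "j \<le> n" "j \<noteq> i" for j
      proof (rule ccontr)
        assume "\<not> 2 * X j \<omega> < X i \<omega>"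
        then have "\<omega> \<in> P i j" using \<omega>(1) \<open>X i \<omega> > y\<close> max that by (simp add: P_def)
        moreover have "(i, j) \<in> I" using that i by (simp add: I_def)
        ultimately show False using \<omega> by blast
      qed
      ultimately have "\<omega> \<in> ?G" using i(1) \<omega>(1) y_ge by force
      then show False using \<omega> by auto
    qed
    then have "prob (space M) \<le> prob (?G \<union> (L \<union> (\<Union>(i, j)\<in>I. P i j)))"
      using PI_meas by (intro finite_measure_mono) auto
    also have "\<dots> \<le> prob ?G + (prob L + prob (\<Union>(i, j)\<in>I. P i j))"
      using PI_meas by (intro order_trans[OF measure_Un_le] add_left_mono measure_Un_le) auto
    finally show ?thesis using PI L K(2) by (simp add: prob_space)
  qed
  show ?thesis
    by (rule that[OF c]) (use ev main in \<open>auto elim: eventually_mono\<close>)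
qed

end

subsection \<open>Convergence in probability\<close>

text \<open>Since |a_j| = exp(exp Y_j - 1) - 1, halving Y amounts to a square root in the inner
  exponential. With s = exp(Y_i / 2) the other coefficients are at most B = exp s, while |a_i| =
  exp(s^2 - 1) - 1; the lower bound required of |a_i| is at most exp(s (1 + 3n)), which is smaller
  because s \<ge> 96 n^2 / \<epsilon>.\<close>

lemma roots_close_if_dominant_log_log:
  fixes a w :: "nat \<Rightarrow> complex" and \<epsilon> c :: real
  assumes n: "n \<ge> 1" and \<epsilon>: "0 < \<epsilon>" "\<epsilon> < 1"
    and large: "96 * (real n)\<^sup>2 / \<epsilon> \<le> exp (c * real n / 2)"
    and i: "i \<le> n" "ln (1 + ln (1 + norm (a i))) > c * real n"
    and others: "\<And>j. j \<le> n \<Longrightarrow> j \<noteq> i \<Longrightarrow> 2 * ln (1 + ln (1 + norm (a j))) < ln (1 + ln (1 + norm (a i)))"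
    and ends: "norm (a 0) \<ge> exp (- real n)" "norm (a n) \<ge> exp (- real n)"
    and w: "enumerates n w (binomial_roots n a)"
  shows "\<exists>z. enumerates n z (proots (coeff_poly n a)) \<and>
    (\<forall>k\<in>{1..n}. norm (z k - w k) < \<epsilon> / n * norm (w k))"
proof -
  define Y where "Y j = ln (1 + ln (1 + norm (a j)))" for j
  define s where "s = exp (Y i / 2)"
  have exp_Y: "exp (Y j) = 1 + ln (1 + norm (a j))" for j
    unfolding Y_def by (intro exp_ln) (auto intro: add_pos_nonneg)
  have norm_eq: "norm (a j) = exp (exp (Y j) - 1) - 1" for j
  proof -
    have "exp (ln (1 + norm (a j))) = 1 + norm (a j)"
      by (intro exp_ln) (auto intro: add_pos_nonneg)
    then show ?thesis by (simp add: exp_Y)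
  qed
  have Y0: "Y j \<ge> 0" for j unfolding Y_def by simp
  have s_sq: "exp (Y i) = s\<^sup>2"
    by (simp add: s_def power2_eq_square flip: exp_add)
  have s_ge: "96 * (real n)\<^sup>2 / \<epsilon> \<le> s"
  proof -
    have "exp (c * real n / 2) \<le> s" unfolding s_def using i(2) by (simp add: Y_def)
    then show ?thesis using large by linarith
  qed
  have n_sq: "real n \<le> (real n)\<^sup>2" using n by (simp add: power2_eq_square)
  have "96 * (real n)\<^sup>2 / 1 \<le> 96 * (real n)\<^sup>2 / \<epsilon>"
    using \<epsilon> by (intro divide_left_mono) auto
  then have s_n: "96 * real n \<le> s" using s_ge n_sq by linarith
  have n1: "real n \<ge> 1" using n by simp
  have t: "max_index n a = i"
    unfolding max_index_def
  proof (rule Least_equality)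
    have lt: "norm (a j) < norm (a i)" if "j \<le> n" "j \<noteq> i" for j
    proof -
      have "Y j < Y i" using others[OF that, folded Y_def] Y0[of j] by linarith
      then show ?thesis by (simp add: norm_eq)
    qed
    then show "i \<le> n \<and> (\<forall>j\<le>n. norm (a j) \<le> norm (a i))"
      using i(1) by (metis less_imp_le order_refl)
    fix t assume t: "t \<le> n \<and> (\<forall>j\<le>n. norm (a j) \<le> norm (a t))"
    then have "t = i" using lt[of t] i(1) by (metis not_le)
    then show "i \<le> t" by simp
  qed
  show ?thesis
  proof (rule roots_close_if_dominant_coeff[OF n \<epsilon> _ t[symmetric] _ _ _ _ w])
    show "1 \<le> exp s" using s_n n1 by simp
    fix j assume j: "j \<le> n" "j \<noteq> i"
    have "exp (Y j) \<le> s" unfolding s_def using others[OF j] by (simp add: Y_def)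
    then have "exp (exp (Y j) - 1) \<le> exp s" by simp
    then show "norm (a j) \<le> exp s" using norm_eq[of j] by linarith
  next
    have "1 / exp s \<le> exp (- real n)"
      using s_n n1 by (simp add: exp_minus inverse_eq_divide frac_le)
    then show "1 / exp s \<le> norm (a 0)" "1 / exp s \<le> norm (a n)" using ends by auto
  next
    have "96 * (real n)\<^sup>2 * (exp s)\<^sup>2 / \<epsilon> = (96 * (real n)\<^sup>2 / \<epsilon>) * exp (2 * s)"
      by (simp add: power2_eq_square flip: exp_add)
    also have "\<dots> \<le> exp s * exp (2 * s)"
    proof (rule mult_right_mono)
      show "96 * (real n)\<^sup>2 / \<epsilon> \<le> exp s" using s_ge exp_ge_add_one_self[of s] by linarith
    qed simp
    also have "\<dots> = exp (3 * s)" by (simp flip: exp_add)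
    finally have "(96 * (real n)\<^sup>2 * (exp s)\<^sup>2 / \<epsilon>) ^ n \<le> exp (3 * s) ^ n"
      using \<epsilon> by (intro power_mono) auto
    also have "\<dots> = exp (real n * (3 * s))" by (simp flip: exp_of_nat_mult)
    finally have "exp s * (96 * (real n)\<^sup>2 * (exp s)\<^sup>2 / \<epsilon>) ^ n \<le> exp s * exp (real n * (3 * s))"
      by (intro mult_left_mono) auto
    also have "\<dots> = exp (s * (1 + 3 * real n))" by (simp add: algebra_simps flip: exp_add)
    \<comment> \<open>As s \<ge> 96n, s - (1 + 3n) \<ge> 2. The 2 in the exponent makes room for the
      subtracted 1 in the next step, where exp 1 \<ge> 2 is used.\<close>
    also have "\<dots> \<le> exp (s\<^sup>2 - 2)"
    proof -
      have "s * 2 \<le> s * (s - (1 + 3 * real n))"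
        using s_n n1 by (intro mult_left_mono) auto
      then show ?thesis using s_n n1 by (simp add: algebra_simps power2_eq_square)
    qed
    also have "\<dots> \<le> exp (s\<^sup>2 - 1) - 1"
    proof -
      have "1 \<le> s * s" using s_n n1 mult_mono[of 1 s 1 s] by auto
      moreover have "2 * exp (s\<^sup>2 - 2) \<le> exp 1 * exp (s\<^sup>2 - 2)"
        using exp_ge_add_one_self[of 1] by (intro mult_right_mono) auto
      moreover have "exp 1 * exp (s\<^sup>2 - 2) = exp (s\<^sup>2 - 1)" by (simp flip: exp_add)
      moreover have "exp (s\<^sup>2 - 2) \<ge> 1"
        using s_n n1 mult_mono[of 2 s 2 s] by (simp add: power2_eq_square)
      ultimately show ?thesis by linarith
    qed
    also have "\<dots> = norm (a i)" by (simp add: norm_eq s_sq)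
    finally show "exp s * (96 * (real n)\<^sup>2 * (exp s)\<^sup>2 / \<epsilon>) ^ n \<le> norm (a i)" .
  qed
qed

theorem theorem2:
  fixes M :: "'a measure" and \<xi> :: "nat \<Rightarrow> 'a \<Rightarrow> complex"
    and w :: "nat \<Rightarrow> 'a \<Rightarrow> nat \<Rightarrow> complex" and \<epsilon> :: real
  assumes "prob_space M"
    and "iid M \<xi>"
    and "measure M {\<omega> \<in> space M. \<xi> 0 \<omega> = 0} = 0"
    and "\<And>n \<omega>. n \<ge> 1 \<Longrightarrow> \<omega> \<in> space M \<Longrightarrow>
           enumerates n (w n \<omega>) (binomial_roots n (\<lambda>k. \<xi> k \<omega>))"
    and "slowly_varying_tail M (\<lambda>\<omega>. ln (1 + ln (1 + norm (\<xi> 0 \<omega>))))"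
    and "0 < \<epsilon>" and "\<epsilon> < 1"
  shows "(\<lambda>n. measure M {\<omega> \<in> space M.
            \<exists>z. enumerates n z (proots (coeff_poly n (\<lambda>k. \<xi> k \<omega>))) \<and>
              (\<forall>k\<in>{1..n}. norm (z k - w n \<omega> k) < \<epsilon> / real n * norm (w n \<omega> k))})
         \<longlonglongrightarrow> 1"
proof -
  interpret prob_space M by fact
  define E where "E n = {\<omega> \<in> space M.
            \<exists>z. enumerates n z (proots (coeff_poly n (\<lambda>k. \<xi> k \<omega>))) \<and>
              (\<forall>k\<in>{1..n}. norm (z k - w n \<omega> k) < \<epsilon> / real n * norm (w n \<omega> k))}" for n
  define g :: "complex \<Rightarrow> real" where "g x = ln (1 + ln (1 + norm x))" for x
  have g_meas [measurable]: "g \<in> borel_measurable borel" unfolding g_def by measurable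
  have indep: "indep_vars (\<lambda>_. borel) \<xi> UNIV" and ident: "\<And>i. distr M borel (\<xi> i) = distr M borel (\<xi> 0)"
    using assms(2) by (auto simp: iid_def)
  have \<xi> [measurable]: "\<xi> i \<in> borel_measurable M" for i
    using indep by (simp add: indep_vars_def)
  have same_prob: "prob (\<xi> i -` A \<inter> space M) = prob (\<xi> 0 -` A \<inter> space M)" if [measurable]: "A \<in> sets borel" for i A
    using measure_distr[OF \<xi> that, of i] measure_distr[OF \<xi> that, of 0] ident[of i] by simp
  define X where "X i \<omega> = g (\<xi> i \<omega>)" for i \<omega>
  have X_indep: "indep_vars (\<lambda>_. borel) X UNIV"
    unfolding X_def using indep by (rule indep_vars_compose2) simp
  have X_tail: "tail_prob M (X i) x = tail_prob M (X 0) x" for i x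
  proof -
    have "{\<omega> \<in> space M. X j \<omega> > x} = \<xi> j -` {z. g z > x} \<inter> space M" for j
      by (auto simp: X_def)
    moreover have "{z. g z > x} \<in> sets borel" by measurable
    ultimately show ?thesis using same_prob[of "{z. g z > x}" i] by (simp add: tail_prob_def)
  qed
  have X_slow: "slowly_varying_tail M (X 0)"
    using assms(5) by (simp add: X_def[abs_def] g_def)
  have E_meas [measurable]: "E n \<in> sets M" if "n \<ge> 1" for n
    unfolding E_def using that assms(4) by (intro sets_Collect_roots_close) auto
  define Z where "Z i n = {\<omega> \<in> space M. norm (\<xi> i \<omega>) < exp (- real n)}" for i n
  have Z_meas [measurable]: "Z i n \<in> sets M" for i n unfolding Z_def by measurable
  \<comment> \<open>The index of the leading coefficient moves with \<open>n\<close>; identical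
    distribution reduces it to \<open>\<xi> 0\<close>.\<close>
  have Z_eq: "prob (Z i n) = prob (Z 0 n)" for i n
  proof -
    have "Z j n = \<xi> j -` {z. norm z < exp (- real n)} \<inter> space M" for j
      by (auto simp: Z_def)
    then show ?thesis using same_prob[of "{z. norm z < exp (- real n)}" i] by simp
  qed
  \<comment> \<open>The events decrease to \<open>\<xi> 0 \<omega> = 0\<close>, which has
    probability zero.\<close>
  have Z_lim: "(\<lambda>n. prob (Z 0 n)) \<longlonglongrightarrow> 0"
  proof -
    have "(\<lambda>n. prob (Z 0 n)) \<longlonglongrightarrow> prob (\<Inter>n. Z 0 n)"
    proof (rule finite_Lim_measure_decseq)
      show "decseq (Z 0)"
        by (intro decseq_SucI) (auto simp: Z_def elim!: less_le_trans)
    qed auto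
    moreover have "(\<Inter>n. Z 0 n) = {\<omega> \<in> space M. \<xi> 0 \<omega> = 0}"
    proof (intro equalityI subsetI)
      fix \<omega> assume \<omega>: "\<omega> \<in> (\<Inter>n. Z 0 n)"
      have "norm (\<xi> 0 \<omega>) \<le> 0"
      proof (rule tendsto_lowerbound)
        show "(\<lambda>n. exp (- real n)) \<longlonglongrightarrow> 0" by real_asymp
        show "eventually (\<lambda>n. norm (\<xi> 0 \<omega>) \<le> exp (- real n)) sequentially"
          using \<omega> by (auto simp: Z_def intro!: always_eventually less_imp_le)
      qed simp
      then show "\<omega> \<in> {\<omega> \<in> space M. \<xi> 0 \<omega> = 0}" using \<omega> by (auto simp: Z_def)
    qed (auto simp: Z_def)
    ultimately show ?thesis using assms(3) by simp
  qed
  have "(\<lambda>n. prob (E n)) \<longlonglongrightarrow> 1"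
  proof (rule order_tendstoI)
    fix y :: real assume y: "y > 1"
    show "eventually (\<lambda>n. prob (E n) < y) sequentially"
      using y by (intro always_eventually allI le_less_trans[OF prob_le_1])
  next
    fix y :: real assume y: "y < 1"
    \<comment> \<open>Three exceptional events cost at most \<delta> each: no dominant value, a
      small constant coefficient, a small leading coefficient. The fourth \<delta> makes the
      inequality strict.\<close>
    define \<delta> where "\<delta> = (1 - y) / 4"
    have \<delta>: "\<delta> > 0" using y by (simp add: \<delta>_def)
    obtain c where c: "c > 0" and dom: "eventually (\<lambda>n. prob {\<omega> \<in> space M. \<exists>i\<le>n. X i \<omega> > c * real n \<and>
        (\<forall>j\<le>n. j \<noteq> i \<longrightarrow> 2 * X j \<omega> < X i \<omega>)} \<ge> 1 - \<delta>) sequentially"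
      using eventually_dominant_value[OF X_indep X_tail X_slow \<delta>] by blast
    have "eventually (\<lambda>n. 96 * (real n)\<^sup>2 / \<epsilon> \<le> exp (c * real n / 2)) sequentially"
      using c assms(6) by real_asymp
    moreover have "eventually (\<lambda>n. prob (Z 0 n) < \<delta>) sequentially"
      using Z_lim \<delta> by (rule order_tendstoD)
    ultimately show "eventually (\<lambda>n. prob (E n) > y) sequentially"
      using dom eventually_ge_at_top[of 1]
    proof eventually_elim
      case (elim n)
      define G where "G = {\<omega> \<in> space M. \<exists>i\<le>n. X i \<omega> > c * real n \<and> (\<forall>j\<le>n. j \<noteq> i \<longrightarrow> 2 * X j \<omega> < X i \<omega>)}"
      have [measurable]: "X i \<in> borel_measurable M" for i unfolding X_def by measurable
      have G_meas [measurable]: "G \<in> sets M" unfolding G_def by measurable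
      have "G \<subseteq> E n \<union> (Z 0 n \<union> Z n n)"
      proof
        fix \<omega> assume "\<omega> \<in> G"
        then obtain i where i: "\<omega> \<in> space M" "i \<le> n" "X i \<omega> > c * real n"
          "\<And>j. j \<le> n \<Longrightarrow> j \<noteq> i \<Longrightarrow> 2 * X j \<omega> < X i \<omega>" by (auto simp: G_def)
        show "\<omega> \<in> E n \<union> (Z 0 n \<union> Z n n)"
        proof (cases "\<omega> \<in> Z 0 n \<union> Z n n")
          case False
          then have "\<exists>z. enumerates n z (proots (coeff_poly n (\<lambda>k. \<xi> k \<omega>))) \<and>
              (\<forall>k\<in>{1..n}. norm (z k - w n \<omega> k) < \<epsilon> / real n * norm (w n \<omega> k))"
            using i elim assms(4,6,7)
            by (intro roots_close_if_dominant_log_log[where i = i and c = c]) (auto simp: X_def g_def Z_def)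
          then show ?thesis using i(1) by (simp add: E_def)
        qed auto
      qed
      then have "prob G \<le> prob (E n \<union> (Z 0 n \<union> Z n n))"
        using elim by (intro finite_measure_mono) auto
      also have "\<dots> \<le> prob (E n) + (prob (Z 0 n) + prob (Z n n))"
        using elim by (intro order_trans[OF measure_Un_le] add_left_mono measure_Un_le) auto
      finally have "1 - \<delta> \<le> prob (E n) + (prob (Z 0 n) + prob (Z n n))"
        using elim by (simp add: G_def)
      moreover have "prob (Z n n) < \<delta>" "prob (Z 0 n) < \<delta>" using Z_eq[of n n] elim by auto
      moreover have "y = 1 - 4 * \<delta>" by (simp add: \<delta>_def field_simps)
      ultimately show ?case using \<delta> by linarith
    qed
  qed
  then show ?thesis by (simp add: E_def)
qed

end
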